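(* For every domain $\Omega\subset\mathbb R^{2n}$, the sequence $$0\to C^\infty(\Omega,\mathscr V_0)\xrightarrow{\mathscr D_0}C^\infty(\Omega,\mathscr V_1)\xrightarrow{\mathscr D_1}C^\infty(\Omega,\mathscr V_2)\xrightarrow{\mathscr D_2}C^\infty(\Omega,\mathscr V_3)\to0$$ is an elliptic differential complex; that is, $\mathscr D_1\circ\mathscr D_0=0$, $\mathscr D_2\circ\mathscr D_1=0$, and for every $\mathbf x\in\Omega$ and $\nu\in\mathbb R^{2n}\setminus\{\mathbf 0\}$ the symbol sequence $$0\to\mathscr V_0\xrightarrow{\sigma(\mathscr D_0)(\mathbf x;\nu)}\mathscr V_1\xrightarrow{\sigma(\mathscr D_1)(\mathbf x;\nu)}\mathscr V_2\xrightarrow{\sigma(\mathscr D_2)(\mathbf x;\nu)}\mathscr V_3\to0$$ is exact.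
   Context: Let $n$ be a positive integer and $m=\lfloor n/2\rfloor$. Let $W$ be a complex vector space with basis $f_1,\dots,f_m$; for $\alpha=\{\alpha_1<\dots<\alpha_h\}\subset\{1,\dots,m\}$ put $f_\alpha=f_{\alpha_1}\wedge\cdots\wedge f_{\alpha_h}$ ($f_\emptyset=1$), a basis of $\wedge^\bullet W$. Let $\varepsilon_j v=f_j\wedge v$, and let $\iota_j f_\alpha=0$ if $j\notin\alpha$, $\iota_j f_\alpha=(-1)^{t+1}f_{\alpha\setminus\{j\}}$ if $j=\alpha_t$. Put $\gamma_{2j-1}=\varepsilon_j-\iota_j$, $\gamma_{2j}=-\mathbf i(\varepsilon_j+\iota_j)$ for $1\le j\le m$ and, if $n=2m+1$, $\gamma_{n}f_\alpha=-\mathbf i(-1)^{\#\alpha}f_\alpha$. The spinor modules are $\mathbb S^+=\wedge^{\rm even}W$, $\mathbb S^-=\wedge^{\rm odd}W$ for $n$ even, and $\mathbb S^+=\mathbb S^-=\wedge^\bullet W$ for $n$ odd. Then $\gamma_j:\mathbb S^\pm\to\mathbb S^\mp$ and $\gamma_j\gamma_k+\gamma_k\gamma_j=-2\delta_{jk}\mathbf 1$. Write points of $\mathbb R^{2n}$ as $\mathbf x=(\mathbf x_0,\mathbf x_1)$ with $\mathbf x_A=(x_{A1},\dots,x_{An})$, $A=0,1$, let $\partial_{Aj}=\partial/\partial x_{Aj}$, and $\nabla_A=\sum_{j=1}^n\gamma_j\partial_{Aj}$. Let $\mathscr V_0=\mathbb S^+$, $\mathscr V_1=\mathbb C^2\otimes\mathbb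 S^-$, $\mathscr V_2=\mathbb C^2\otimes\mathbb S^-$, $\mathscr V_3=\mathbb S^+$; elements of $\mathscr V_1,\mathscr V_2$ are written as columns $(g_0,g_1)^T$. The operators are $(\mathscr D_0f)_A=\nabla_Af$; $(\mathscr D_1g)_A=\nabla_0\nabla_Ag_1-\nabla_1\nabla_Ag_0$ for $A=0,1$; $\mathscr D_2h=\nabla_0h_1-\nabla_1h_0$. The symbol $\sigma(\mathscr D)(\mathbf x;\nu)$ of a matrix differential operator $\mathscr D$ of order $r$ is the linear map obtained from its terms of order exactly $r$ by replacing each $\partial_{Aj}$ by $\nu_{Aj}/\mathbf i$, where $\nu=(\nu_{01},\dots,\nu_{0n},\nu_{11},\dots,\nu_{1n})$. The order is $1$ for $\mathscr D_0,\mathscr D_2$ and $2$ for $\mathscr D_1$. *)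

theory Defs
  imports "HOL-Analysis.Analysis"
begin

text \<open>
  The number \<open>n\<close> is \<open>CARD('n)\<close> for an index type of sort \<open>{finite, linorder}\<close>; its elements are
  numbered \<open>1, \<dots>, n\<close> in increasing order by \<open>idx\<close>, with inverse \<open>elt\<close>.
  Points of \<open>\<real>\<^sup>2\<^sup>n\<close> have type \<open>real ^ 'n ^ 2\<close>: the coordinate \<open>x\<^sub>A\<^sub>j\<close> is \<open>x $ A $ elt j\<close>, where
  \<open>A\<close> is \<open>0\<close> or \<open>1\<close> in the two-element type \<open>2\<close>.
\<close>

type_synonym 'n point = "real ^ 'n ^ 2"

definition idx :: "'n::{finite,linorder} \<Rightarrow> nat" where
  "idx j = card {k. k \<le> j}"

definition elt :: "nat \<Rightarrow> 'n::{finite,linorder}" where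
  "elt k = (THE j. idx j = k)"


section \<open>The exterior algebra and the spinor modules\<close>

text \<open>
  \<open>'n exterior\<close> is the exterior algebra on generators indexed by all of \<open>'n\<close>, the coefficient of a
  vector \<open>v\<close> at \<open>f\<^sub>\<alpha>\<close> being \<open>v $ \<alpha>\<close>. The exterior algebra of \<open>W\<close>, on \<open>f\<^sub>1, \<dots>, f\<^sub>m\<close>
  with \<open>m = \<lfloor>n/2\<rfloor>\<close>, is the subspace \<open>ext_W\<close> below; \<open>f\<^sub>j\<close> is \<open>basis_f {elt j}\<close>.
\<close>

type_synonym 'n exterior = "complex ^ ('n set)"

definition basis_f :: "'n set \<Rightarrow> ('n::{finite,linorder}) exterior" where
  "basis_f \<alpha> = axis \<alpha> 1"

text \<open>
  \<open>f\<^sub>\<alpha> \<and> f\<^sub>\<beta>\<close> is \<open>0\<close> unless \<open>\<alpha>\<close> and \<open>\<beta>\<close> are disjoint, and then equals \<open>f\<^bsub>\<alpha> \<union> \<beta>\<^esub>\<close> with the sign given by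
  the number of inversions.
\<close>
definition wedge :: "('n::{finite,linorder}) exterior \<Rightarrow> 'n exterior \<Rightarrow> 'n exterior" where
  "wedge v w = (\<chi> \<delta>. \<Sum>\<alpha>\<in>Pow \<delta>.
     (-1) ^ card {(a, b). a \<in> \<alpha> \<and> b \<in> \<delta> - \<alpha> \<and> b < a} * v $ \<alpha> * w $ (\<delta> - \<alpha>))"

definition lin_ext ::
  "('n set \<Rightarrow> ('n::{finite,linorder}) exterior) \<Rightarrow> 'n exterior \<Rightarrow> 'n exterior" where
  "lin_ext \<phi> v = (\<Sum>\<alpha>\<in>UNIV. v $ \<alpha> *s \<phi> \<alpha>)"

definition eps :: "nat \<Rightarrow> ('n::{finite,linorder}) exterior \<Rightarrow> 'n exterior" where
  "eps j v = wedge (basis_f {elt j}) v"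

text \<open>If \<open>j = \<alpha>\<^sub>t\<close> then \<open>t\<close> is the number of elements of \<open>\<alpha>\<close> that are at most \<open>j\<close>.\<close>
definition iota :: "nat \<Rightarrow> ('n::{finite,linorder}) exterior \<Rightarrow> 'n exterior" where
  "iota j = lin_ext (\<lambda>\<alpha>. if elt j \<in> \<alpha>
     then (-1) ^ (card {k \<in> \<alpha>. k \<le> elt j} + 1) *s basis_f (\<alpha> - {elt j}) else 0)"

definition clifford_gamma :: "nat \<Rightarrow> ('n::{finite,linorder}) exterior \<Rightarrow> 'n exterior" where
  "clifford_gamma k v =
    (if odd CARD('n) \<and> k = CARD('n) then lin_ext (\<lambda>\<alpha>. (- \<i> * (-1) ^ card \<alpha>) *s basis_f \<alpha>) v
     else if odd k then eps ((k + 1) div 2) v - iota ((k + 1) div 2) v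
     else (- \<i>) *s (eps (k div 2) v + iota (k div 2) v))"

definition ext_W :: "('n::{finite,linorder}) exterior set" where
  "ext_W = {v. \<forall>\<alpha>. v $ \<alpha> \<noteq> 0 \<longrightarrow> \<alpha> \<subseteq> elt ` {1..CARD('n) div 2}}"

definition S_plus :: "('n::{finite,linorder}) exterior set" where
  "S_plus = (if even CARD('n) then {v \<in> ext_W. \<forall>\<alpha>. v $ \<alpha> \<noteq> 0 \<longrightarrow> even (card \<alpha>)} else ext_W)"

definition S_minus :: "('n::{finite,linorder}) exterior set" where
  "S_minus = (if even CARD('n) then {v \<in> ext_W. \<forall>\<alpha>. v $ \<alpha> \<noteq> 0 \<longrightarrow> odd (card \<alpha>)} else ext_W)"

text \<open>\<open>\<complex>\<^sup>2 \<otimes> \<and>\<^sup>\<bullet>W\<close>: the column \<open>(g\<^sub>0, g\<^sub>1)\<^sup>T\<close> has entries \<open>g\<^sub>A = entry g A\<close>.\<close>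

type_synonym 'n exterior2 = "complex ^ (2 \<times> 'n set)"

definition entry :: "('n::{finite,linorder}) exterior2 \<Rightarrow> 2 \<Rightarrow> 'n exterior" where
  "entry g A = (\<chi> \<alpha>. g $ (A, \<alpha>))"

definition column :: "(2 \<Rightarrow> ('n::{finite,linorder}) exterior) \<Rightarrow> 'n exterior2" where
  "column G = (\<chi> p. G (fst p) $ snd p)"

definition V0 :: "('n::{finite,linorder}) exterior set" where
  "V0 = S_plus"

definition V1 :: "('n::{finite,linorder}) exterior2 set" where
  "V1 = {g. \<forall>A. entry g A \<in> S_minus}"

definition V2 :: "('n::{finite,linorder}) exterior2 set" where
  "V2 = {g. \<forall>A. entry g A \<in> S_minus}"

definition V3 :: "('n::{finite,linorder}) exterior set" where
  "V3 = S_plus"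


section \<open>Smooth functions\<close>

definition partial :: "2 \<times> 'n::finite \<Rightarrow> ('n point \<Rightarrow> 'b::real_normed_vector) \<Rightarrow> 'n point \<Rightarrow> 'b"
  where "partial p f x = frechet_derivative f (at x) (axis (fst p) (axis (snd p) 1))"

primrec Ck_on :: "nat \<Rightarrow> (('n::finite) point) set \<Rightarrow> ('n point \<Rightarrow> 'b::real_normed_vector) \<Rightarrow> bool"
  where
    "Ck_on 0 \<Omega> f \<longleftrightarrow> continuous_on \<Omega> f"
  | "Ck_on (Suc k) \<Omega> f \<longleftrightarrow> f differentiable_on \<Omega> \<and> (\<forall>p. Ck_on k \<Omega> (partial p f))"

text \<open>
  Only used for open \<open>\<Omega>\<close>. An element of \<open>C\<^sup>\<infinity>(\<Omega>, V)\<close> is represented by total functions whose values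
  outside \<open>\<Omega>\<close> are irrelevant.
\<close>
definition C_inf ::
  "(('n::finite) point) set \<Rightarrow> ('b::real_normed_vector) set \<Rightarrow> ('n point \<Rightarrow> 'b) set" where
  "C_inf \<Omega> V = {f. (\<forall>k. Ck_on k \<Omega> f) \<and> f ` \<Omega> \<subseteq> V}"


section \<open>Matrix differential operators and their symbols\<close>

text \<open>
  A word \<open>w = [p\<^sub>1, \<dots>, p\<^sub>k]\<close> of coordinate labels stands for \<open>\<partial>\<^bsub>p\<^sub>1\<^esub> \<dots> \<partial>\<^bsub>p\<^sub>k\<^esub>\<close>. Words are used in place of
  multi-indices, so an operator may have several coefficient families; they all give the same
  symbol on \<open>V\<close>, because \<open>\<Sum>\<^bsub>|w| = r\<^esub> \<nu>\<^bsub>p\<^sub>1\<^esub> \<dots> \<nu>\<^bsub>p\<^sub>r\<^esub> a\<^sub>w(x) u\<close> is the value at \<open>x\<close> of the operator applied to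
  \<open>y \<mapsto> (\<nu> \<bullet> (y - x))\<^sup>r u / r!\<close>.
\<close>
definition has_coeffs ::
  "(('n::finite) point) set \<Rightarrow> (complex ^ 'k::finite) set \<Rightarrow> nat \<Rightarrow>
   (('n point \<Rightarrow> complex ^ 'k) \<Rightarrow> 'n point \<Rightarrow> complex ^ 'l::finite) \<Rightarrow>
   ((2 \<times> 'n) list \<Rightarrow> 'n point \<Rightarrow> complex ^ 'k ^ 'l) \<Rightarrow> bool" where
  "has_coeffs \<Omega> V r D a \<longleftrightarrow>
     (\<forall>f\<in>C_inf \<Omega> V. \<forall>x\<in>\<Omega>. D f x = (\<Sum>w\<in>{w. length w \<le> r}. a w x *v foldr partial w f x))"

definition diff_op ::
  "(('n::finite) point) set \<Rightarrow> (complex ^ 'k::finite) set \<Rightarrow> nat \<Rightarrow>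
   (('n point \<Rightarrow> complex ^ 'k) \<Rightarrow> 'n point \<Rightarrow> complex ^ 'l::finite) \<Rightarrow> bool" where
  "diff_op \<Omega> V r D \<longleftrightarrow> (\<exists>a. has_coeffs \<Omega> V r D a)"

text \<open>Meaningful for \<open>diff_op \<Omega> V r D\<close>, \<open>x \<in> \<Omega>\<close> and \<open>u \<in> V\<close>.\<close>
definition symbol ::
  "(('n::finite) point) set \<Rightarrow> (complex ^ 'k::finite) set \<Rightarrow> nat \<Rightarrow>
   (('n point \<Rightarrow> complex ^ 'k) \<Rightarrow> 'n point \<Rightarrow> complex ^ 'l::finite) \<Rightarrow>
   'n point \<Rightarrow> 'n point \<Rightarrow> complex ^ 'k \<Rightarrow> complex ^ 'l" where
  "symbol \<Omega> V r D x \<nu> u =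
     (\<Sum>w\<in>{w. length w = r}.
        (\<Prod>(A, j)\<leftarrow>w. complex_of_real (\<nu> $ A $ j) / \<i>) *s ((SOME a. has_coeffs \<Omega> V r D a) w x *v u))"


section \<open>The operators\<close>

definition nabla ::
  "2 \<Rightarrow> (('n::{finite,linorder}) point \<Rightarrow> 'n exterior) \<Rightarrow> 'n point \<Rightarrow> 'n exterior" where
  "nabla A f x = (\<Sum>j\<in>UNIV. clifford_gamma (idx j) (partial (A, j) f x))"

definition D0 ::
  "(('n::{finite,linorder}) point \<Rightarrow> 'n exterior) \<Rightarrow> 'n point \<Rightarrow> 'n exterior2" where
  "D0 f x = column (\<lambda>A. nabla A f x)"

definition D1 ::
  "(('n::{finite,linorder}) point \<Rightarrow> 'n exterior2) \<Rightarrow> 'n point \<Rightarrow> 'n exterior2" where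
  "D1 g x = column (\<lambda>A. nabla 0 (nabla A (\<lambda>y. entry (g y) 1)) x
                      - nabla 1 (nabla A (\<lambda>y. entry (g y) 0)) x)"

definition D2 ::
  "(('n::{finite,linorder}) point \<Rightarrow> 'n exterior2) \<Rightarrow> 'n point \<Rightarrow> 'n exterior" where
  "D2 h x = nabla 0 (\<lambda>y. entry (h y) 1) x - nabla 1 (\<lambda>y. entry (h y) 0) x"

end

theory Submission
  imports Defs
begin

text \<open>
  Everything rests on one identity: by the Clifford relations, the square of \<open>\<nabla>\<^sub>A\<close> is the scalar
  operator \<open>- \<Delta>\<^sub>A\<close>, where \<open>\<Delta>\<^sub>A\<close> is the Laplacian in the variables \<open>x\<^sub>A\<close>
  (\<open>nabla_nabla\<close>). Hence \<open>\<nabla>\<^sub>A\<nabla>\<^sub>A\<close> commutes with \<open>\<nabla>\<^sub>B\<close>, although \<open>\<nabla>\<^sub>0\<close> and \<open>\<nabla>\<^sub>1\<close>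
  do not commute with each other, and the two compositions \<open>D1 \<circ> D0\<close> and \<open>D2 \<circ> D1\<close> consist of
  terms \<open>\<plusminus> (\<nabla>\<^sub>B\<nabla>\<^sub>A\<nabla>\<^sub>A - \<nabla>\<^sub>A\<nabla>\<^sub>A\<nabla>\<^sub>B)\<close> only.

  For the symbols, let \<open>s\<^sub>A\<close> (\<open>slash\<close>) be the symbol of \<open>\<nabla>\<^sub>A\<close>. The same identity gives
  \<open>s\<^sub>A\<^sup>2 = |\<nu>\<^sub>A|\<^sup>2\<close>, and \<open>\<nu> \<noteq> 0\<close> means that \<open>s\<^sub>A\<close> is invertible for \<open>A = 0\<close> or for \<open>A = 1\<close>. The
  symbol sequence is \<open>f \<mapsto> (s\<^sub>0 f, s\<^sub>1 f)\<close>, \<open>g \<mapsto> (s\<^sub>0 s\<^sub>A g\<^sub>1 - s\<^sub>1 s\<^sub>A g\<^sub>0)\<^sub>A\<close>,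
  \<open>h \<mapsto> s\<^sub>0 h\<^sub>1 - s\<^sub>1 h\<^sub>0\<close>, and an invertible \<open>s\<^sub>A\<close> provides an explicit preimage at every place:
  \<open>f = s\<^sub>A\<^sup>-\<^sup>1 g\<^sub>A\<close> for \<open>g\<close> in the kernel of the second map; for \<open>h\<close> in the kernel of the third map,
  \<open>(0, |\<nu>\<^sub>0|\<^sup>-\<^sup>2 h\<^sub>0)\<close> if \<open>\<nu>\<^sub>0 \<noteq> 0\<close> and \<open>(- |\<nu>\<^sub>1|\<^sup>-\<^sup>2 h\<^sub>1, 0)\<close> if \<open>\<nu>\<^sub>1 \<noteq> 0\<close>; and at the last
  place a column with the single nonzero entry \<open>\<plusminus> s\<^sub>A\<^sup>-\<^sup>1 u\<close>.

  Three preparations are needed. Partial derivatives of smooth functions commute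
  (\<open>partial_commute\<close>). The symbol of an operator with constant coefficients can be read off
  from any way of writing it as a sum over words (\<open>constant_coefficient_operator\<close>). Finally, each
  \<open>\<gamma>\<^sub>k\<close> is a monomial map of the basis: up to a fourth root of unity, it adds or removes one
  generator or fixes each basis vector (\<open>gamma_nth\<close>); this reduces the Clifford relations
  (\<open>clifford_relation\<close>) to a count of signs.
\<close>

section \<open>Partial derivatives\<close>

abbreviation dir :: "2 \<times> 'n::finite \<Rightarrow> 'n point" where
  "dir p \<equiv> axis (fst p) (axis (snd p) 1)"

lemma inner_dir: "\<nu> \<bullet> dir p = \<nu> $ fst p $ snd p"
  by (simp add: inner_axis)

lemma partial_eqI: "(f has_derivative f') (at x) \<Longrightarrow> partial p f x = f' (dir p)"
  unfolding partial_def using frechet_derivative_at by metis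

lemma has_derivative_open_cong:
  assumes "open \<Omega>" "x \<in> \<Omega>" "\<And>y. y \<in> \<Omega> \<Longrightarrow> f y = g y"
  shows "(f has_derivative f') (at x) \<longleftrightarrow> (g has_derivative f') (at x)"
  using has_derivative_transform_within_open[OF _ assms(1,2), of f f' UNIV g]
    has_derivative_transform_within_open[OF _ assms(1,2), of g f' UNIV f] assms(3) by auto

lemma partial_cong:
  assumes "open \<Omega>" "x \<in> \<Omega>" "\<And>y. y \<in> \<Omega> \<Longrightarrow> f y = g y"
  shows "partial p f x = partial p g x"
  unfolding partial_def frechet_derivative_def using has_derivative_open_cong[OF assms] by simp

lemma partial_bounded_linear:
  assumes "bounded_linear L" "f differentiable (at x)"
  shows "partial p (\<lambda>y. L (f y)) x = L (partial p f x)"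
proof -
  from assms(2) obtain f' where f': "(f has_derivative f') (at x)"
    unfolding differentiable_def by blast
  show ?thesis
    using partial_eqI[OF bounded_linear.has_derivative[OF assms(1) f']] partial_eqI[OF f'] by simp
qed

lemma partial_sum:
  assumes "\<And>i. i \<in> I \<Longrightarrow> f i differentiable (at x)"
  shows "partial p (\<lambda>y. \<Sum>i\<in>I. f i y) x = (\<Sum>i\<in>I. partial p (f i) x)"
proof -
  have "(f i has_derivative frechet_derivative (f i) (at x)) (at x)" if "i \<in> I" for i
    using assms[OF that] frechet_derivative_works by blast
  then have "((\<lambda>y. \<Sum>i\<in>I. f i y) has_derivative
      (\<lambda>h. \<Sum>i\<in>I. frechet_derivative (f i) (at x) h)) (at x)"
    by (rule has_derivative_sum)
  from partial_eqI[OF this] show ?thesis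
    by (simp add: partial_def)
qed

text \<open>A linear functional that vanishes on \<open>V\<close> also annihilates the derivatives of a \<open>V\<close>-valued
  function, and a subspace is cut out by such functionals.\<close>

lemma partial_in_subspace:
  fixes f :: "('n::finite) point \<Rightarrow> 'b::euclidean_space"
  assumes "open \<Omega>" "x \<in> \<Omega>" "f differentiable (at x)" "subspace V" "f ` \<Omega> \<subseteq> V"
  shows "partial p f x \<in> V"
proof -
  have "z \<bullet> partial p f x = 0" if z: "z \<in> V\<^sup>\<bottom>" for z
  proof -
    have "z \<bullet> partial p f x = partial p (\<lambda>y. z \<bullet> f y) x"
      by (rule partial_bounded_linear[OF bounded_linear_inner_right assms(3), symmetric])
    also have "\<dots> = partial p (\<lambda>y. 0) x"
    proof (rule partial_cong[OF assms(1,2)])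
      fix y assume "y \<in> \<Omega>"
      then have "f y \<bullet> z = 0"
        using z assms(5) by (auto simp: orthogonal_comp_def orthogonal_def image_subset_iff)
      then show "z \<bullet> f y = 0"
        by (simp add: inner_commute)
    qed
    also have "\<dots> = 0"
      by (rule partial_eqI[OF has_derivative_const])
    finally show ?thesis .
  qed
  then have "partial p f x \<in> V\<^sup>\<bottom>\<^sup>\<bottom>"
    unfolding orthogonal_comp_def[of "V\<^sup>\<bottom>"] orthogonal_def by simp
  then show ?thesis
    using orthogonal_comp_self[OF assms(4)] by simp
qed


section \<open>Smooth functions\<close>

definition smooth_on :: "('n::finite) point set \<Rightarrow> ('n point \<Rightarrow> 'b::real_normed_vector) \<Rightarrow> bool" where
  "smooth_on \<Omega> f \<longleftrightarrow> (\<forall>k. Ck_on k \<Omega> f)"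

lemma C_inf_iff: "f \<in> C_inf \<Omega> V \<longleftrightarrow> smooth_on \<Omega> f \<and> f ` \<Omega> \<subseteq> V"
  by (simp add: C_inf_def smooth_on_def)

lemma Ck_on_cong:
  assumes "open \<Omega>" "\<And>y. y \<in> \<Omega> \<Longrightarrow> f y = g y"
  shows "Ck_on k \<Omega> f \<longleftrightarrow> Ck_on k \<Omega> g"
  using assms(2)
proof (induction k arbitrary: f g)
  case 0
  then show ?case
    unfolding Ck_on.simps(1) by (rule continuous_on_cong[OF refl])
next
  case (Suc k)
  have "(f has_derivative D) (at x) \<longleftrightarrow> (g has_derivative D) (at x)" if "x \<in> \<Omega>" for x D
    by (rule has_derivative_open_cong[OF assms(1) that Suc.prems])
  then have "f differentiable_on \<Omega> \<longleftrightarrow> g differentiable_on \<Omega>"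
    unfolding differentiable_on_eq_differentiable_at[OF assms(1)] differentiable_def by simp
  moreover have "Ck_on k \<Omega> (partial p f) \<longleftrightarrow> Ck_on k \<Omega> (partial p g)" for p
    by (rule Suc.IH[OF partial_cong[OF assms(1) _ Suc.prems]])
  ultimately show ?case
    unfolding Ck_on.simps(2) by simp
qed

lemma Ck_on_Suc_differentiable:
  assumes "open \<Omega>" "Ck_on (Suc k) \<Omega> f" "x \<in> \<Omega>"
  shows "f differentiable (at x)"
  using assms differentiable_on_eq_differentiable_at[OF assms(1), of f] by auto

lemma Ck_on_bounded_linear:
  assumes "open \<Omega>" "bounded_linear L" "Ck_on k \<Omega> f"
  shows "Ck_on k \<Omega> (\<lambda>y. L (f y))"
  using assms(3)
proof (induction k arbitrary: f)
  case 0
  then show ?case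
    using bounded_linear.continuous_on[OF assms(2)] by simp
next
  case (Suc k)
  have d: "f differentiable (at x)" if "x \<in> \<Omega>" for x
    using Ck_on_Suc_differentiable[OF assms(1) Suc.prems that] .
  have "(\<lambda>y. L (f y)) differentiable (at x)" if "x \<in> \<Omega>" for x
    using d[OF that] bounded_linear.has_derivative[OF assms(2)]
    unfolding differentiable_def by blast
  then have "(\<lambda>y. L (f y)) differentiable_on \<Omega>"
    by (simp add: differentiable_on_eq_differentiable_at[OF assms(1)])
  moreover have "Ck_on k \<Omega> (partial p (\<lambda>y. L (f y)))" for p
  proof -
    have "Ck_on k \<Omega> (partial p f)"
      using Suc.prems unfolding Ck_on.simps(2) by blast
    then have "Ck_on k \<Omega> (\<lambda>y. L (partial p f y))"
      by (rule Suc.IH)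
    moreover have "partial p (\<lambda>y. L (f y)) y = L (partial p f y)" if "y \<in> \<Omega>" for y
      by (rule partial_bounded_linear[OF assms(2) d[OF that]])
    ultimately show ?thesis
      by (subst Ck_on_cong[OF assms(1)])
  qed
  ultimately show ?case
    unfolding Ck_on.simps(2) by (intro conjI allI)
qed

lemma Ck_on_sum:
  assumes "open \<Omega>" "finite I" "\<And>i. i \<in> I \<Longrightarrow> Ck_on k \<Omega> (f i)"
  shows "Ck_on k \<Omega> (\<lambda>y. \<Sum>i\<in>I. f i y)"
  using assms(3)
proof (induction k arbitrary: f)
  case 0
  then have "continuous_on \<Omega> (f i)" if "i \<in> I" for i
    using that by simp
  then show ?case
    unfolding Ck_on.simps(1) by (rule continuous_on_sum)
next
  case (Suc k)
  have d: "f i differentiable (at x)" if "x \<in> \<Omega>" "i \<in> I" for x i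
    by (rule Ck_on_Suc_differentiable[OF assms(1) Suc.prems[OF that(2)] that(1)])
  have "(\<lambda>y. \<Sum>i\<in>I. f i y) differentiable (at x)" if "x \<in> \<Omega>" for x
    using d[OF that] assms(2) by (intro differentiable_sum) auto
  then have "(\<lambda>y. \<Sum>i\<in>I. f i y) differentiable_on \<Omega>"
    by (simp add: differentiable_on_eq_differentiable_at[OF assms(1)])
  moreover have "Ck_on k \<Omega> (partial p (\<lambda>y. \<Sum>i\<in>I. f i y))" for p
  proof -
    have "Ck_on k \<Omega> (partial p (f i))" if "i \<in> I" for i
      using Suc.prems[OF that] unfolding Ck_on.simps(2) by blast
    then have "Ck_on k \<Omega> (\<lambda>y. \<Sum>i\<in>I. partial p (f i) y)"
      by (rule Suc.IH)
    moreover have "partial p (\<lambda>y. \<Sum>i\<in>I. f i y) y = (\<Sum>i\<in>I. partial p (f i) y)" if "y \<in> \<Omega>" for y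
      by (rule partial_sum[OF d[OF that]])
    ultimately show ?thesis
      by (subst Ck_on_cong[OF assms(1)])
  qed
  ultimately show ?case
    unfolding Ck_on.simps(2) by (intro conjI allI)
qed

lemma smooth_on_partial:
  assumes "smooth_on \<Omega> f"
  shows "smooth_on \<Omega> (partial p f)"
  unfolding smooth_on_def
proof
  fix k
  have "Ck_on (Suc k) \<Omega> f" using assms unfolding smooth_on_def ..
  then have "\<forall>p. Ck_on k \<Omega> (partial p f)" unfolding Ck_on.simps(2) ..
  then show "Ck_on k \<Omega> (partial p f)" ..
qed

lemma smooth_on_differentiable:
  assumes "open \<Omega>" "smooth_on \<Omega> f" "x \<in> \<Omega>"
  shows "f differentiable (at x)"
  by (rule Ck_on_Suc_differentiable[OF assms(1) _ assms(3)])
    (rule assms(2)[unfolded smooth_on_def, rule_format, of "Suc 0"])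

lemma smooth_on_bounded_linear:
  assumes "open \<Omega>" "bounded_linear L" "smooth_on \<Omega> f"
  shows "smooth_on \<Omega> (\<lambda>y. L (f y))"
  unfolding smooth_on_def
  by (intro allI Ck_on_bounded_linear[OF assms(1,2)] assms(3)[unfolded smooth_on_def, rule_format])

lemma smooth_on_sum:
  assumes "open \<Omega>" "finite I" "\<And>i. i \<in> I \<Longrightarrow> smooth_on \<Omega> (f i)"
  shows "smooth_on \<Omega> (\<lambda>y. \<Sum>i\<in>I. f i y)"
  unfolding smooth_on_def
  by (intro allI Ck_on_sum[OF assms(1,2)] assms(3)[unfolded smooth_on_def, rule_format])

lemma smooth_on_continuous: "smooth_on \<Omega> f \<Longrightarrow> continuous_on \<Omega> f"
  unfolding smooth_on_def by (drule spec[of _ 0]) simp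


section \<open>Symmetry of second derivatives\<close>

lemma line_mvt:
  fixes g :: "('n::finite) point \<Rightarrow> real"
  assumes "0 < t"
    and "\<And>s. 0 \<le> s \<Longrightarrow> s \<le> t \<Longrightarrow> g differentiable (at (x + s *\<^sub>R dir p))"
  shows "\<exists>s. 0 < s \<and> s < t \<and> g (x + t *\<^sub>R dir p) - g x = t * partial p g (x + s *\<^sub>R dir p)"
proof -
  let ?d = "\<lambda>s h. frechet_derivative g (at (x + s *\<^sub>R dir p)) (h *\<^sub>R dir p)"
  have "((\<lambda>s. g (x + s *\<^sub>R dir p)) has_derivative ?d s) (at s within {0..t})"
    if "0 \<le> s" "s \<le> t" for s
  proof -
    have "(g has_derivative frechet_derivative g (at (x + s *\<^sub>R dir p))) (at (x + s *\<^sub>R dir p))"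
      using assms(2)[OF that] by (simp only: frechet_derivative_works)
    moreover have "((\<lambda>s. x + s *\<^sub>R dir p) has_derivative (\<lambda>h. h *\<^sub>R dir p)) (at s within {0..t})"
      by (auto intro!: derivative_eq_intros)
    ultimately show ?thesis
      by (rule has_derivative_compose[rotated])
  qed
  then have "\<exists>s\<in>{0<..<t}. g (x + t *\<^sub>R dir p) - g (x + 0 *\<^sub>R dir p) = ?d s (t - 0)"
    by (rule mvt_simple[OF assms(1)])
  then obtain s where s: "0 < s" "s < t" "g (x + t *\<^sub>R dir p) - g x = ?d s t"
    by auto
  have "linear (frechet_derivative g (at (x + s *\<^sub>R dir p)))"
    using assms(2)[of s] s by (intro linear_frechet_derivative) auto
  then have "?d s t = t * partial p g (x + s *\<^sub>R dir p)"
    by (simp add: partial_def linear_cmul)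
  with s show ?thesis by auto
qed

text \<open>The mean value theorem in the direction \<open>p\<close>, and then in the direction \<open>q\<close>, expresses the
  second difference by a value of \<open>\<partial>\<^sub>q\<partial>\<^sub>p g\<close> near \<open>x\<close>; it is itself symmetric in \<open>p\<close> and \<open>q\<close>.\<close>

lemma second_difference:
  fixes g :: "('n::finite) point \<Rightarrow> real"
  assumes "0 < t" "ball x r \<subseteq> \<Omega>" "open \<Omega>" "2 * t < r" "smooth_on \<Omega> g"
  shows "\<exists>\<xi>. dist \<xi> x \<le> 2 * t \<and>
    g (x + t *\<^sub>R dir p + t *\<^sub>R dir q) - g (x + t *\<^sub>R dir p) - g (x + t *\<^sub>R dir q) + g x
      = t\<^sup>2 * partial q (partial p g) \<xi>"
proof -
  have near: "dist (x + s *\<^sub>R dir p + s' *\<^sub>R dir q) x \<le> 2 * t"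
    if "0 \<le> s" "s \<le> t" "0 \<le> s'" "s' \<le> t" for s s' and p q :: "2 \<times> 'n"
  proof -
    have "norm (s *\<^sub>R dir p + s' *\<^sub>R dir q) \<le> \<bar>s\<bar> * norm (dir p) + \<bar>s'\<bar> * norm (dir q)"
      by (rule order_trans[OF norm_triangle_ineq]) simp
    also have "\<dots> \<le> 2 * t"
      using that by simp
    finally show ?thesis by (simp add: dist_norm add.assoc)
  qed
  have inside: "x + s *\<^sub>R dir p + s' *\<^sub>R dir q \<in> \<Omega>"
    if "0 \<le> s" "s \<le> t" "0 \<le> s'" "s' \<le> t" for s s' 
    using near[OF that, of p q] assms(2,4) by (auto simp: dist_commute)
  define h where "h y = g (y + t *\<^sub>R dir q) - g y" for y
  have dg: "g differentiable (at y)" if "y \<in> \<Omega>" for y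
    using smooth_on_differentiable[OF assms(3,5) that] .
  have shift: "((\<lambda>y. y + t *\<^sub>R dir q) has_derivative (\<lambda>v. v)) (at y)" for y
    by (auto intro!: derivative_eq_intros)
  have dgs: "((\<lambda>y. g (y + t *\<^sub>R dir q)) has_derivative
      frechet_derivative g (at (x + s *\<^sub>R dir p + t *\<^sub>R dir q))) (at (x + s *\<^sub>R dir p))"
    if "0 \<le> s" "s \<le> t" for s
    by (rule has_derivative_compose[OF shift])
      (use dg[OF inside[OF that, of t]] assms(1) frechet_derivative_works in auto)
  have dh: "(h has_derivative (\<lambda>v. frechet_derivative g (at (x + s *\<^sub>R dir p + t *\<^sub>R dir q)) v
      - frechet_derivative g (at (x + s *\<^sub>R dir p)) v)) (at (x + s *\<^sub>R dir p))"
    if "0 \<le> s" "s \<le> t" for s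
    unfolding h_def
    by (rule has_derivative_diff[OF dgs[OF that]])
      (use dg[OF inside[OF that, of 0]] assms(1) frechet_derivative_works in auto)
  have "h differentiable (at (x + s *\<^sub>R dir p))" if "0 \<le> s" "s \<le> t" for s
    unfolding differentiable_def by (rule exI, rule dh[OF that])
  from line_mvt[OF assms(1) this]
  obtain s where s: "0 < s" "s < t" "h (x + t *\<^sub>R dir p) - h x = t * partial p h (x + s *\<^sub>R dir p)"
    by blast
  have ph: "partial p h (x + s *\<^sub>R dir p) =
      partial p g (x + s *\<^sub>R dir p + t *\<^sub>R dir q) - partial p g (x + s *\<^sub>R dir p)"
    using partial_eqI[OF dh[of s]] s by (simp add: partial_def)
  have "partial p g differentiable (at (x + s *\<^sub>R dir p + s' *\<^sub>R dir q))" if "0 \<le> s'" "s' \<le> t" for s'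
    using s that inside by (intro smooth_on_differentiable[OF assms(3) smooth_on_partial[OF assms(5)]]) auto
  from line_mvt[OF assms(1) this]
  obtain s' where s': "0 < s'" "s' < t"
    "partial p g (x + s *\<^sub>R dir p + t *\<^sub>R dir q) - partial p g (x + s *\<^sub>R dir p)
      = t * partial q (partial p g) (x + s *\<^sub>R dir p + s' *\<^sub>R dir q)"
    by blast
  have "dist (x + s *\<^sub>R dir p + s' *\<^sub>R dir q) x \<le> 2 * t"
    using near s s' by simp
  moreover have "g (x + t *\<^sub>R dir p + t *\<^sub>R dir q) - g (x + t *\<^sub>R dir p) - g (x + t *\<^sub>R dir q) + g x
      = t\<^sup>2 * partial q (partial p g) (x + s *\<^sub>R dir p + s' *\<^sub>R dir q)"
    using s(3) ph s'(3) by (simp add: h_def power2_eq_square algebra_simps)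
  ultimately show ?thesis by blast
qed

text \<open>Two second differences with the same step \<open>t\<close> but exchanged directions agree, so
  \<open>\<partial>\<^sub>q\<partial>\<^sub>p g\<close> and \<open>\<partial>\<^sub>p\<partial>\<^sub>q g\<close> take a common value at points within \<open>2t\<close> of \<open>x\<close>; continuity
  makes them equal at \<open>x\<close> in the limit \<open>t \<rightarrow> 0\<close>.\<close>

lemma partial_commute_real:
  fixes g :: "('n::finite) point \<Rightarrow> real"
  assumes "open \<Omega>" "smooth_on \<Omega> g" "x \<in> \<Omega>"
  shows "partial q (partial p g) x = partial p (partial q g) x"
proof (rule ccontr)
  let ?G = "\<lambda>y. partial q (partial p g) y" and ?H = "\<lambda>y. partial p (partial q g) y"
  assume ne: "?G x \<noteq> ?H x"
  \<comment> \<open>A quarter of the gap: both values move by less than \<open>e\<close>, so they cannot meet.\<close>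
  define e where "e = \<bar>?G x - ?H x\<bar> / 4"
  have e: "e > 0" using ne by (simp add: e_def)
  have "isCont ?G x" "isCont ?H x"
    using smooth_on_continuous[OF smooth_on_partial[OF smooth_on_partial[OF assms(2)]]]
      continuous_on_eq_continuous_at[OF assms(1)] assms(3) by blast+
  then obtain d1 d2 where d: "d1 > 0" "d2 > 0"
    "\<And>y. dist y x < d1 \<Longrightarrow> \<bar>?G y - ?G x\<bar> < e" "\<And>y. dist y x < d2 \<Longrightarrow> \<bar>?H y - ?H x\<bar> < e"
    using e unfolding continuous_at_eps_delta dist_real_def by metis
  obtain r where r: "r > 0" "ball x r \<subseteq> \<Omega>"
    using assms openE by blast
  define t where "t = min r (min d1 d2) / 4"
  have t: "0 < t" "2 * t < r" "2 * t < d1" "2 * t < d2"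
    using r d by (auto simp: t_def min_def)
  from second_difference[OF t(1) r(2) assms(1) t(2) assms(2), of p q]
  obtain \<xi> where \<xi>: "dist \<xi> x \<le> 2 * t"
    "g (x + t *\<^sub>R dir p + t *\<^sub>R dir q) - g (x + t *\<^sub>R dir p) - g (x + t *\<^sub>R dir q) + g x = t\<^sup>2 * ?G \<xi>"
    by blast
  from second_difference[OF t(1) r(2) assms(1) t(2) assms(2), of q p]
  obtain \<eta> where \<eta>: "dist \<eta> x \<le> 2 * t"
    "g (x + t *\<^sub>R dir q + t *\<^sub>R dir p) - g (x + t *\<^sub>R dir q) - g (x + t *\<^sub>R dir p) + g x = t\<^sup>2 * ?H \<eta>"
    by blast
  have "t\<^sup>2 * ?G \<xi> = t\<^sup>2 * ?H \<eta>"
    using \<xi>(2) \<eta>(2) by (simp add: algebra_simps)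
  then have "?G \<xi> = ?H \<eta>" using t by simp
  moreover have "\<bar>?G \<xi> - ?G x\<bar> < e" "\<bar>?H \<eta> - ?H x\<bar> < e"
    using d \<xi>(1) \<eta>(1) t by auto
  ultimately have "?G x - ?H x < 2 * e" "?H x - ?G x < 2 * e"
    by (auto simp: abs_less_iff)
  then show False
    using e by (auto simp: e_def abs_if split: if_splits)
qed

lemma partial_commute:
  fixes f :: "('n::finite) point \<Rightarrow> 'b::euclidean_space"
  assumes "open \<Omega>" "smooth_on \<Omega> f" "x \<in> \<Omega>"
  shows "partial q (partial p f) x = partial p (partial q f) x"
proof (rule euclidean_eqI)
  fix b :: 'b assume "b \<in> Basis"
  let ?L = "\<lambda>v. v \<bullet> b"
  have L: "bounded_linear ?L" by (rule bounded_linear_inner_left)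
  have two: "?L (partial q (partial p f) x) = partial q (partial p (\<lambda>y. ?L (f y))) x" for p q
  proof -
    have d: "f differentiable (at y)" if "y \<in> \<Omega>" for y
      using smooth_on_differentiable[OF assms(1,2) that] .
    have "?L (partial q (partial p f) x) = partial q (\<lambda>y. ?L (partial p f y)) x"
      using smooth_on_differentiable[OF assms(1) smooth_on_partial[OF assms(2)] assms(3)]
      by (intro partial_bounded_linear[OF L, symmetric])
    also have "\<dots> = partial q (partial p (\<lambda>y. ?L (f y))) x"
      by (rule partial_cong[OF assms(1,3) partial_bounded_linear[OF L d, symmetric]])
    finally show ?thesis .
  qed
  show "?L (partial q (partial p f) x) = ?L (partial p (partial q f) x)"
    unfolding two
    by (rule partial_commute_real[OF assms(1) smooth_on_bounded_linear[OF assms(1) L assms(2)] assms(3)])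
qed


section \<open>Operators with constant coefficients\<close>

text \<open>Coefficient matrices act complex linearly, whereas differentiation only commutes with maps that
  are real linear and bounded; \<open>clinear_bounded_linear\<close> passes from the first to the second.\<close>

abbreviation clinear :: "(complex ^ 'k::finite \<Rightarrow> complex ^ 'l::finite) \<Rightarrow> bool" where
  "clinear \<equiv> Vector_Spaces.linear (*s) (*s)"

lemma clinearI:
  assumes "\<And>u v. f (u + v) = f u + f v" "\<And>c v. f (c *s v) = c *s f v"
  shows "clinear f"
  unfolding Vector_Spaces.linear_iff
  by (intro conjI allI vec.vector_space_axioms assms)

lemma clinear_add: "clinear f \<Longrightarrow> f (u + v) = f u + f v"
  by (simp add: Vector_Spaces.linear_iff)

lemma clinear_scale: "clinear f \<Longrightarrow> f (c *s v) = c *s f v"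
  by (simp add: Vector_Spaces.linear_iff)

lemma scaleR_eq_scale: "r *\<^sub>R v = complex_of_real r *s v" for v :: "complex ^ 'k::finite"
  by (simp add: vec_eq_iff scaleR_conv_of_real[symmetric] del: of_real_mult)

lemma clinear_bounded_linear:
  assumes "clinear f"
  shows "bounded_linear f"
  using assms by (intro linear_conv_bounded_linear[THEN iffD1] linearI)
    (simp_all add: clinear_add clinear_scale scaleR_eq_scale)

lemma clinear_linear: "clinear f \<Longrightarrow> linear f"
  by (rule bounded_linear.linear[OF clinear_bounded_linear])

lemma clinear_sum: "clinear f \<Longrightarrow> f (\<Sum>i\<in>I. g i) = (\<Sum>i\<in>I. f (g i))"
  by (rule linear_sum[OF clinear_linear])

lemma clinear_compose_sum:
  assumes "\<And>i. i \<in> I \<Longrightarrow> clinear (f i)"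
  shows "clinear (\<lambda>v. \<Sum>i\<in>I. f i v)"
  using assms
  by (intro clinearI) (simp_all add: clinear_add clinear_scale sum.distrib vec.scale_sum_right)

lemma clinear_comp: "clinear f \<Longrightarrow> clinear g \<Longrightarrow> clinear (\<lambda>v. f (g v))"
  by (intro clinearI) (simp_all add: clinear_add clinear_scale)

lemma finite_words: "finite {w :: ('a::finite) list. length w \<le> r}"
  using finite_lists_length_le[of "UNIV :: 'a set" r] by simp

lemma sum_words_Suc:
  "(\<Sum>w | length w = Suc r. G w) = (\<Sum>p\<in>UNIV. \<Sum>w | length w = r. G (p # w))"
  for G :: "('a::finite) list \<Rightarrow> 'b::comm_monoid_add"
proof -
  have "(\<Sum>w | length w = Suc r. G w) = (\<Sum>z\<in>UNIV \<times> {w. length w = r}. G (fst z # snd z))"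
    by (rule sum.reindex_bij_witness[where i = "\<lambda>z. fst z # snd z" and j = "\<lambda>w. (hd w, tl w)"])
      (auto simp: length_Suc_conv)
  then show ?thesis
    by (simp add: sum.cartesian_product case_prod_beta)
qed

text \<open>The test functions: \<open>monomial \<nu> x u (1 / r!) r\<close> is \<open>y \<mapsto> (\<nu> \<bullet> (y - x))\<^sup>r u / r!\<close>. The free
  constant and exponent make the family closed under partial derivatives. When \<open>m = 0\<close>, the
  exponent \<open>m - 1\<close> is \<open>0\<close> and it is the factor \<open>of_nat m\<close> that makes the derivative vanish.\<close>

definition monomial :: "('n::finite) point \<Rightarrow> 'n point \<Rightarrow> 'b \<Rightarrow> real \<Rightarrow> nat \<Rightarrow> 'n point \<Rightarrow> 'b::real_normed_vector"
  where "monomial \<nu> x u c m y = (c * (\<nu> \<bullet> (y - x)) ^ m) *\<^sub>R u"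

lemma monomial_has_derivative:
  "(monomial \<nu> x u c m has_derivative
    (\<lambda>h. (c * (of_nat m * (\<nu> \<bullet> h) * (\<nu> \<bullet> (y - x)) ^ (m - 1))) *\<^sub>R u)) (at y)"
  unfolding monomial_def by (auto intro!: derivative_eq_intros)

lemma partial_monomial:
  "partial p (monomial \<nu> x u c m) = monomial \<nu> x u (c * of_nat m * \<nu> $ fst p $ snd p) (m - 1)"
  by (rule ext) (simp add: partial_eqI[OF monomial_has_derivative] inner_dir monomial_def mult_ac)

lemma smooth_on_monomial: "smooth_on \<Omega> (monomial \<nu> x u c m)"
  unfolding smooth_on_def
proof
  fix k show "Ck_on k \<Omega> (monomial \<nu> x u c m)"
  proof (induction k arbitrary: c m)
    case 0
    show ?case
      unfolding Ck_on.simps(1) monomial_def by (intro continuous_intros)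
  next
    case (Suc k)
    have "monomial \<nu> x u c m differentiable (at y within \<Omega>)" for y
      by (rule differentiableI[OF has_derivative_at_withinI[OF monomial_has_derivative]])
    then show ?case
      unfolding Ck_on.simps(2) differentiable_on_def partial_monomial
      by (intro conjI ballI allI Suc.IH)
  qed
qed

definition word_prod :: "('n::finite) point \<Rightarrow> (2 \<times> 'n) list \<Rightarrow> real" where
  "word_prod \<nu> w = (\<Prod>p\<leftarrow>w. \<nu> $ fst p $ snd p)"

lemma partial_word_monomial:
  assumes "length w \<le> r"
  shows "foldr partial w (monomial \<nu> x u (1 / fact r) r)
    = monomial \<nu> x u (word_prod \<nu> w / fact (r - length w)) (r - length w)"
  using assms
proof (induction w)
  case Nil
  then show ?case by (simp add: word_prod_def)
next
  case (Cons p w)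
  then have "r - length w = Suc (r - length (p # w))" by simp
  then have "real (r - length w) / fact (r - length w) = 1 / fact (r - length (p # w))"
    by (simp only: fact_Suc) (simp del: of_nat_Suc length_Cons)
  then have "word_prod \<nu> w / fact (r - length w) * real (r - length w) * \<nu> $ fst p $ snd p
      = word_prod \<nu> (p # w) / fact (r - length (p # w))"
    by (simp add: word_prod_def divide_simps mult_ac del: length_Cons)
  moreover have "r - length w - 1 = r - length (p # w)" by simp
  ultimately show ?case
    using Cons by (simp add: partial_monomial del: length_Cons)
qed

lemma partial_word_monomial_at:
  assumes "length w \<le> r"
  shows "foldr partial w (monomial \<nu> x u (1 / fact r) r) x
    = (if length w = r then word_prod \<nu> w *\<^sub>R u else 0)"
  using assms by (simp add: partial_word_monomial monomial_def)

lemma symbol_weight: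
  "(\<Prod>(A, j)\<leftarrow>w. complex_of_real (\<nu> $ A $ j) / \<i>) = (1 / \<i>) ^ length w * complex_of_real (word_prod \<nu> w)"
  by (induction w) (auto simp: word_prod_def)

text \<open>At \<open>x\<close>, the derivatives of order below \<open>r\<close> of the test function vanish and those of order
  \<open>r\<close> are \<open>\<nu>\<^sub>w u\<close>. Hence the top order part of any coefficient family, evaluated at \<open>\<nu>\<close>, is the
  value of the operator on the test function; the right hand side does not mention \<open>a\<close>.\<close>

lemma symbol_has_coeffs:
  fixes V :: "(complex ^ 'k::finite) set"
  assumes "has_coeffs \<Omega> V r D a" "x \<in> \<Omega>" "subspace V" "u \<in> V"
  shows "(\<Sum>w | length w = r. (\<Prod>(A, j)\<leftarrow>w. complex_of_real (\<nu> $ A $ j) / \<i>) *s (a w x *v u))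
    = (1 / \<i>) ^ r *s D (monomial \<nu> x u (1 / fact r) r) x"
proof -
  let ?f = "monomial \<nu> x u (1 / fact r) r"
  have "?f \<in> C_inf \<Omega> V"
    using assms(3,4) by (auto simp: C_inf_iff smooth_on_monomial monomial_def intro: subspace_mul)
  then have "D ?f x = (\<Sum>w | length w \<le> r. a w x *v foldr partial w ?f x)"
    using assms(1,2) unfolding has_coeffs_def by blast
  also have "\<dots> = (\<Sum>w | length w = r. a w x *v (word_prod \<nu> w *\<^sub>R u))"
    by (intro sum.mono_neutral_cong_right finite_words)
      (auto simp: partial_word_monomial_at)
  also have "\<dots> = (\<Sum>w | length w = r. complex_of_real (word_prod \<nu> w) *s (a w x *v u))"
    by (simp add: scaleR_eq_scale vector_scalar_commute)
  finally have "(1 / \<i>) ^ r *s D ?f x =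
      (\<Sum>w | length w = r. (1 / \<i>) ^ r *s (complex_of_real (word_prod \<nu> w) *s (a w x *v u)))"
    by (simp only: vec.scale_sum_right)
  also have "\<dots> = (\<Sum>w | length w = r. (\<Prod>(A, j)\<leftarrow>w. complex_of_real (\<nu> $ A $ j) / \<i>) *s (a w x *v u))"
    by (intro sum.cong refl) (simp only: symbol_weight vec.scale_scale mem_Collect_eq)
  finally show ?thesis by (rule sym)
qed

text \<open>The symbol is defined by an arbitrary choice of coefficients. By \<open>symbol_has_coeffs\<close> the chosen
  family and the family \<open>L\<close> give the same value on \<open>V\<close>.\<close>

lemma constant_coefficient_operator:
  fixes V :: "(complex ^ 'k::finite) set"
    and D :: "(('n::finite) point \<Rightarrow> complex ^ 'k) \<Rightarrow> 'n point \<Rightarrow> complex ^ 'l::finite"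
  assumes L: "\<And>w. clinear (L w)"
    and D: "\<And>f x. f \<in> C_inf \<Omega> V \<Longrightarrow> x \<in> \<Omega> \<Longrightarrow> D f x = (\<Sum>w | length w = r. L w (foldr partial w f x))"
  shows "diff_op \<Omega> V r D"
    and "subspace V \<Longrightarrow> x \<in> \<Omega> \<Longrightarrow> u \<in> V \<Longrightarrow> symbol \<Omega> V r D x \<nu> u =
      (\<Sum>w | length w = r. (\<Prod>(A, j)\<leftarrow>w. complex_of_real (\<nu> $ A $ j) / \<i>) *s L w u)"
proof -
  define b :: "(2 \<times> 'n) list \<Rightarrow> 'n point \<Rightarrow> complex ^ 'k ^ 'l"
    where "b w y = (if length w = r then matrix (L w) else 0)" for w y
  have b: "b w y *v v = (if length w = r then L w v else 0)" for w y v
    by (simp add: b_def matrix_works[OF L])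
  have "has_coeffs \<Omega> V r D b"
    unfolding has_coeffs_def
  proof (intro ballI)
    fix f x assume "f \<in> C_inf \<Omega> V" "x \<in> \<Omega>"
    then have "D f x = (\<Sum>w | length w = r. L w (foldr partial w f x))"
      by (rule D)
    also have "\<dots> = (\<Sum>w | length w \<le> r. b w x *v foldr partial w f x)"
      by (rule sum.mono_neutral_cong_left[OF finite_words]) (auto simp: b)
    finally show "D f x = (\<Sum>w | length w \<le> r. b w x *v foldr partial w f x)" .
  qed
  then show "diff_op \<Omega> V r D"
    unfolding diff_op_def by (rule exI[of "has_coeffs \<Omega> V r D" b])
  assume V: "subspace V" "x \<in> \<Omega>" "u \<in> V"
  have "has_coeffs \<Omega> V r D (SOME a. has_coeffs \<Omega> V r D a)"
    using \<open>has_coeffs \<Omega> V r D b\<close> by (rule someI[of "has_coeffs \<Omega> V r D" b])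
  from symbol_has_coeffs[OF this V(2,1,3), of \<nu>]
    symbol_has_coeffs[OF \<open>has_coeffs \<Omega> V r D b\<close> V(2,1,3), of \<nu>]
  have "symbol \<Omega> V r D x \<nu> u =
      (\<Sum>w | length w = r. (\<Prod>(A, j)\<leftarrow>w. complex_of_real (\<nu> $ A $ j) / \<i>) *s (b w x *v u))"
    unfolding symbol_def by (simp only:)
  also have "\<dots> = (\<Sum>w | length w = r. (\<Prod>(A, j)\<leftarrow>w. complex_of_real (\<nu> $ A $ j) / \<i>) *s L w u)"
    by (rule sum.cong[OF refl]) (simp only: b mem_Collect_eq if_True refl)
  finally show "symbol \<Omega> V r D x \<nu> u =
      (\<Sum>w | length w = r. (\<Prod>(A, j)\<leftarrow>w. complex_of_real (\<nu> $ A $ j) / \<i>) *s L w u)" .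
qed


section \<open>The Clifford relations\<close>

lemma idx_strict_mono: "j < k \<Longrightarrow> idx j < idx (k :: 'n::{finite,linorder})"
  unfolding idx_def
  by (rule psubset_card_mono) (auto simp: psubset_eq set_eq_iff not_le[symmetric] intro: exI[of _ k])

lemma inj_idx: "inj (idx :: 'n::{finite,linorder} \<Rightarrow> nat)"
proof (rule injI)
  fix j k :: 'n assume "idx j = idx k"
  then show "j = k"
    using idx_strict_mono[of j k] idx_strict_mono[of k j] by (cases j k rule: linorder_cases) auto
qed

lemma range_idx: "range (idx :: 'n::{finite,linorder} \<Rightarrow> nat) = {1..CARD('n)}"
proof (rule card_subset_eq)
  show "range (idx :: 'n \<Rightarrow> nat) \<subseteq> {1..CARD('n)}"
  proof (rule image_subsetI)
    fix j :: 'n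
    have "card {k. k \<le> j} > 0" by (auto simp: card_gt_0_iff)
    moreover have "card {k. k \<le> j} \<le> CARD('n)" by (rule card_mono) auto
    ultimately show "idx j \<in> {1..CARD('n)}" by (simp add: idx_def)
  qed
  show "card (range (idx :: 'n \<Rightarrow> nat)) = card {1..CARD('n)}"
    using card_image[OF inj_idx] by simp
qed simp

lemma idx_elt:
  assumes "k \<in> {1..CARD('n)}"
  shows "idx (elt k :: 'n::{finite,linorder}) = k"
proof -
  obtain j :: 'n where j: "idx j = k" using assms range_idx by (metis imageE)
  then have "elt k = j"
    unfolding elt_def using inj_idx by (auto intro!: the_equality dest: injD)
  with j show ?thesis by simp
qed

lemma elt_eq_iff:
  assumes "k \<in> {1..CARD('n)}" "l \<in> {1..CARD('n)}"
  shows "(elt k :: 'n::{finite,linorder}) = elt l \<longleftrightarrow> k = l"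
  using idx_elt[OF assms(1)] idx_elt[OF assms(2)] by metis

text \<open>Both \<open>\<epsilon>\<^sub>j\<close> and \<open>\<iota>\<^sub>j\<close> send \<open>f\<^sub>\<alpha>\<close> to \<open>0\<close> or to plus or minus \<open>f\<^sub>\<beta>\<close>, where \<open>\<beta>\<close> is the symmetric difference of
  \<open>\<alpha>\<close> and \<open>{j}\<close>. Exactly one of the two is nonzero on \<open>f\<^sub>\<alpha>\<close>, so that \<open>\<epsilon>\<^sub>j \<plusminus> \<iota>\<^sub>j\<close> is a signed
  permutation of the basis. The sign is the Jordan--Wigner sign \<open>sign_below\<close>.\<close>

definition toggle :: "'a \<Rightarrow> 'a set \<Rightarrow> 'a set" where
  "toggle a \<delta> = (if a \<in> \<delta> then \<delta> - {a} else insert a \<delta>)"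

lemma mem_toggle: "x \<in> toggle a \<delta> \<longleftrightarrow> (if x = a then x \<notin> \<delta> else x \<in> \<delta>)"
  by (auto simp: toggle_def)

lemma toggle_toggle [simp]: "toggle a (toggle a \<delta>) = \<delta>"
  by (auto simp: set_eq_iff mem_toggle)

lemma toggle_commute: "toggle a (toggle b \<delta>) = toggle b (toggle a \<delta>)"
  by (auto simp: set_eq_iff mem_toggle)

lemma neg_one_power_card_toggle:
  "(-1) ^ card (toggle a \<delta>) = - ((-1) ^ card \<delta> :: complex)" if "finite \<delta>"
proof (cases "a \<in> \<delta>")
  case True
  then have "card \<delta> = Suc (card (\<delta> - {a}))"
    using card_Suc_Diff1[OF that True] by simp
  then show ?thesis using True by (simp add: toggle_def del: card_Diff_insert)
qed (use that in \<open>simp add: toggle_def\<close>)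

definition sign_below :: "'a::{finite,linorder} \<Rightarrow> 'a set \<Rightarrow> complex" where
  "sign_below a \<delta> = (-1) ^ card {k \<in> \<delta>. k < a}"

lemma sign_below_square: "sign_below a \<delta> * sign_below a \<delta> = 1"
  by (simp add: sign_below_def)

lemma sign_below_toggle:
  "sign_below a (toggle b \<delta>) = (if b < a then - sign_below a \<delta> else sign_below a \<delta>)"
proof (cases "b < a")
  case True
  then have "{k \<in> toggle b \<delta>. k < a} = toggle b {k \<in> \<delta>. k < a}"
    by (auto simp: mem_toggle)
  then show ?thesis
    using True by (simp add: sign_below_def neg_one_power_card_toggle)
next
  case False
  then have "{k \<in> toggle b \<delta>. k < a} = {k \<in> \<delta>. k < a}"
    by (auto simp: mem_toggle)
  then show ?thesis
    using False by (simp add: sign_below_def)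
qed

lemma eps_nth:
  fixes v :: "('n::{finite,linorder}) exterior"
  shows "eps j v $ \<delta> =
    (if elt j \<in> \<delta> then sign_below (elt j) \<delta> * v $ (toggle (elt j) \<delta>) else 0)"
proof -
  let ?a = "elt j :: 'n"
  let ?g = "\<lambda>\<alpha>. (-1) ^ card {(a, b). a \<in> \<alpha> \<and> b \<in> \<delta> - \<alpha> \<and> b < a} * basis_f {?a} $ \<alpha> * v $ (\<delta> - \<alpha>)"
  have "eps j v $ \<delta> = (\<Sum>\<alpha>\<in>Pow \<delta>. ?g \<alpha>)"
    by (simp add: eps_def wedge_def)
  also have "\<dots> = (\<Sum>\<alpha>\<in>Pow \<delta>. if \<alpha> = {?a} then ?g {?a} else 0)"
    by (rule sum.cong) (auto simp: basis_f_def axis_def)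
  also have "\<dots> = (if ?a \<in> \<delta> then ?g {?a} else 0)"
    by (simp add: sum.delta)
  also have "\<dots> = (if ?a \<in> \<delta> then sign_below ?a \<delta> * v $ (toggle ?a \<delta>) else 0)"
  proof -
    have "{(a, b). a \<in> {?a} \<and> b \<in> \<delta> - {?a} \<and> b < a} = Pair ?a ` {k \<in> \<delta>. k < ?a}"
      by auto
    then have "card {(a, b). a \<in> {?a} \<and> b \<in> \<delta> - {?a} \<and> b < a} = card {k \<in> \<delta>. k < ?a}"
      by (simp add: card_image inj_on_def)
    then show ?thesis
      by (simp add: basis_f_def axis_def sign_below_def toggle_def)
  qed
  finally show ?thesis .
qed

lemma lin_ext_nth: "lin_ext \<phi> v $ \<delta> = (\<Sum>\<alpha>\<in>UNIV. v $ \<alpha> * \<phi> \<alpha> $ \<delta>)"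
  by (simp add: lin_ext_def)

lemma iota_nth:
  fixes v :: "('n::{finite,linorder}) exterior"
  shows "iota j v $ \<delta> =
    (if elt j \<in> \<delta> then 0 else sign_below (elt j) \<delta> * v $ (toggle (elt j) \<delta>))"
proof -
  let ?a = "elt j :: 'n"
  let ?c = "\<lambda>\<alpha>. if ?a \<in> \<alpha> then
     (-1) ^ (card {k \<in> \<alpha>. k \<le> ?a} + 1) *s (basis_f (\<alpha> - {?a}) :: 'n exterior) else 0"
  have "iota j v $ \<delta> = (\<Sum>\<alpha>\<in>UNIV. v $ \<alpha> * ?c \<alpha> $ \<delta>)"
    by (simp add: iota_def lin_ext_nth)
  also have "\<dots> = (\<Sum>\<alpha>\<in>UNIV. if \<alpha> = insert ?a \<delta> then v $ \<alpha> * ?c \<alpha> $ \<delta> else 0)"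
    by (rule sum.cong) (auto simp: basis_f_def axis_def)
  also have "\<dots> = v $ insert ?a \<delta> * ?c (insert ?a \<delta>) $ \<delta>"
    by simp
  also have "\<dots> = (if ?a \<in> \<delta> then 0 else sign_below ?a \<delta> * v $ (toggle ?a \<delta>))"
  proof (cases "?a \<in> \<delta>")
    case False
    have "{k \<in> insert ?a \<delta>. k \<le> ?a} = insert ?a {k \<in> \<delta>. k < ?a}"
      using False by (auto simp: less_le)
    then have "card {k \<in> insert ?a \<delta>. k \<le> ?a} = Suc (card {k \<in> \<delta>. k < ?a})"
      by simp
    then show ?thesis
      using False by (simp add: basis_f_def axis_def sign_below_def toggle_def)
  qed (auto simp: basis_f_def axis_def)
  finally show ?thesis .
qed

text \<open>The exceptional generator \<open>\<gamma>\<^sub>n\<close> for odd \<open>n\<close>. The argument of type \<open>'n itself\<close> carries \<open>n\<close>.\<close>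

definition last_gamma :: "'n itself \<Rightarrow> nat \<Rightarrow> bool" where
  "last_gamma _ k \<longleftrightarrow> odd CARD('n) \<and> k = CARD('n)"

text \<open>The basis index \<open>j\<close> shared by \<open>\<gamma>\<^bsub>2j-1\<^esub>\<close> and \<open>\<gamma>\<^bsub>2j\<^esub>\<close>: division rounds down, so \<open>(k + 1) div 2\<close> is
  \<open>j\<close> for both.\<close>

definition gamma_elt :: "nat \<Rightarrow> 'n::{finite,linorder}" where
  "gamma_elt k = elt ((k + 1) div 2)"

definition gamma_coeff :: "nat \<Rightarrow> ('n::{finite,linorder}) set \<Rightarrow> complex" where
  "gamma_coeff k \<delta> =
    (if last_gamma TYPE('n) k then - \<i> * (-1) ^ card \<delta>
     else if odd k then (if gamma_elt k \<in> \<delta> then 1 else -1) * sign_below (gamma_elt k) \<delta>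
     else - \<i> * sign_below (gamma_elt k) \<delta>)"

definition gamma_set :: "nat \<Rightarrow> ('n::{finite,linorder}) set \<Rightarrow> 'n set" where
  "gamma_set k \<delta> = (if last_gamma TYPE('n) k then \<delta> else toggle (gamma_elt k) \<delta>)"

text \<open>The coefficient of \<open>\<gamma>\<^sub>k v\<close> at \<open>\<delta>\<close> comes from a single coefficient of \<open>v\<close>, which makes
  products of \<open>\<gamma>\<close>'s computable.\<close>

lemma gamma_nth: "clifford_gamma k v $ \<delta> = gamma_coeff k \<delta> * v $ gamma_set k \<delta>"
  for v :: "('n::{finite,linorder}) exterior"
proof (cases "last_gamma TYPE('n) k")
  case True
  then have "clifford_gamma k v $ \<delta> =
      (\<Sum>\<alpha>\<in>UNIV. v $ \<alpha> * ((- \<i> * (-1) ^ card \<alpha>) *s basis_f \<alpha> :: 'n exterior) $ \<delta>)"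
    by (simp add: clifford_gamma_def lin_ext_nth last_gamma_def)
  also have "\<dots> = (\<Sum>\<alpha>\<in>UNIV. if \<alpha> = \<delta> then v $ \<alpha> * (- \<i> * (-1) ^ card \<alpha>) else 0)"
    by (rule sum.cong) (auto simp: basis_f_def axis_def)
  also have "\<dots> = gamma_coeff k \<delta> * v $ gamma_set k \<delta>"
    using True by (simp add: gamma_coeff_def gamma_set_def)
  finally show ?thesis .
next
  case False
  moreover have "k div 2 = (k + 1) div 2" if "even k" using that by simp
  ultimately show ?thesis
    by (auto simp: clifford_gamma_def last_gamma_def eps_nth iota_nth
        gamma_coeff_def gamma_set_def gamma_elt_def algebra_simps)
qed

lemma clinear_gamma: "clinear (clifford_gamma k)"
  by (rule clinearI) (simp_all add: vec_eq_iff gamma_nth algebra_simps)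

lemma gamma_elt_range:
  assumes "k \<in> {1..CARD('n::{finite,linorder})}" "\<not> last_gamma TYPE('n) k"
  shows "(k + 1) div 2 \<in> {1..CARD('n) div 2}"
  using assms by (auto simp: last_gamma_def elim!: evenE oddE)

lemma gamma_coeff_square:
  "gamma_coeff k \<delta> * gamma_coeff k (gamma_set k \<delta>) = -1"
  by (auto simp: gamma_coeff_def gamma_set_def sign_below_toggle mem_toggle
      algebra_simps simp flip: power2_eq_square)
    (simp_all add: power2_eq_square sign_below_square)

text \<open>Toggling an element below \<open>a\<close> changes \<open>sign_below a\<close>, and toggling one above does not. For two
  different elements exactly one of the two orders of composition picks up this sign. For
  \<open>\<gamma>\<^bsub>2j-1\<^esub>\<close> and \<open>\<gamma>\<^bsub>2j\<^esub>\<close> the sign comes from the membership of the common element, and for the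
  exceptional \<open>\<gamma>\<^sub>n\<close> from the parity of the cardinality.\<close>

lemma gamma_coeff_anticommute:
  fixes \<delta> :: "('n::{finite,linorder}) set"
  assumes "k \<in> {1..CARD('n)}" "l \<in> {1..CARD('n)}" "k \<noteq> l"
  shows "gamma_coeff k \<delta> * gamma_coeff l (gamma_set k \<delta>)
    + gamma_coeff l \<delta> * gamma_coeff k (gamma_set l \<delta>) = 0"
proof -
  consider (last) "last_gamma TYPE('n) k \<or> last_gamma TYPE('n) l"
    | (pair) "\<not> last_gamma TYPE('n) k" "\<not> last_gamma TYPE('n) l" "(gamma_elt k :: 'n) = gamma_elt l"
    | (distinct) "\<not> last_gamma TYPE('n) k" "\<not> last_gamma TYPE('n) l"
        "(gamma_elt k :: 'n) < gamma_elt l \<or> (gamma_elt l :: 'n) < gamma_elt k"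
    by force
  then show ?thesis
  proof cases
    case last
    moreover have "\<not> (last_gamma TYPE('n) k \<and> last_gamma TYPE('n) l)"
      using assms(3) by (auto simp: last_gamma_def)
    ultimately show ?thesis
      by (auto simp: gamma_coeff_def gamma_set_def neg_one_power_card_toggle)
  next
    case pair
    have "(k + 1) div 2 \<in> {1..CARD('n)}" "(l + 1) div 2 \<in> {1..CARD('n)}"
      using gamma_elt_range[OF assms(1) pair(1)] gamma_elt_range[OF assms(2) pair(2)] by auto
    then have "(k + 1) div 2 = (l + 1) div 2"
      using pair(3) elt_eq_iff unfolding gamma_elt_def by blast
    then have "odd k \<longleftrightarrow> even l"
      using assms(3) by presburger
    with pair show ?thesis
      by (auto simp: gamma_coeff_def gamma_set_def sign_below_toggle mem_toggle)
  next
    case distinct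
    then show ?thesis
      by (auto simp: gamma_coeff_def gamma_set_def sign_below_toggle mem_toggle)
  qed
qed

text \<open>The relations hold on the exterior algebra of all \<open>n\<close> generators, which contains the spinor
  modules.\<close>

theorem clifford_relation:
  fixes v :: "('n::{finite,linorder}) exterior"
  shows "clifford_gamma (idx j) (clifford_gamma (idx k) v) + clifford_gamma (idx k) (clifford_gamma (idx j) v)
    = (if (j :: 'n) = k then - 2 else 0) *s v"
proof (cases "j = k")
  case True
  have "gamma_set (idx k) (gamma_set (idx k) \<delta>) = \<delta>" for \<delta> :: "'n set"
    by (simp add: gamma_set_def)
  with True show ?thesis
    by (simp add: vec_eq_iff gamma_nth gamma_coeff_square mult.assoc[symmetric])
next
  case False
  have "gamma_set (idx k) (gamma_set (idx j) \<delta>) = gamma_set (idx j) (gamma_set (idx k) \<delta>)"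
    for \<delta> :: "'n set"
    by (simp add: gamma_set_def toggle_commute)
  moreover have "idx j \<in> {1..CARD('n)}" "idx k \<in> {1..CARD('n)}" "idx j \<noteq> idx k"
    using False inj_idx range_idx by (auto dest: injD)
  ultimately show ?thesis
    using False gamma_coeff_anticommute[where 'n = 'n, of "idx j" "idx k"]
    by (simp add: vec_eq_iff gamma_nth mult.assoc[symmetric] flip: distrib_right)
qed


section \<open>The spinor modules\<close>

text \<open>Both spinor modules at once: \<open>spinors True\<close> is \<open>S\<^sup>+\<close> and \<open>spinors False\<close> is \<open>S\<^sup>-\<close>.
  For odd \<open>n\<close> the two coincide.\<close>

definition spinors :: "bool \<Rightarrow> ('n::{finite,linorder}) exterior set" where
  "spinors b = {v. \<forall>\<alpha>. v $ \<alpha> \<noteq> 0 \<longrightarrow>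
    \<alpha> \<subseteq> elt ` {1..CARD('n) div 2} \<and> (even CARD('n) \<longrightarrow> even (card \<alpha>) = b)}"

lemma S_plus_eq_spinors: "S_plus = spinors True"
  by (auto simp: S_plus_def spinors_def ext_W_def)

lemma S_minus_eq_spinors: "S_minus = spinors False"
  by (auto simp: S_minus_def spinors_def ext_W_def)

lemma zero_in_spinors: "0 \<in> spinors b"
  by (simp add: spinors_def)

lemma add_in_spinors:
  assumes "u \<in> spinors b" "v \<in> spinors b"
  shows "u + v \<in> spinors b"
proof -
  have "u $ \<alpha> \<noteq> 0 \<or> v $ \<alpha> \<noteq> 0" if "(u + v) $ \<alpha> \<noteq> 0" for \<alpha>
    using that by auto
  with assms show ?thesis unfolding spinors_def by blast
qed

lemma scale_in_spinors: "v \<in> spinors b \<Longrightarrow> c *s v \<in> spinors b"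
  by (simp add: spinors_def)

lemma sum_in_spinors: "(\<And>i. i \<in> I \<Longrightarrow> g i \<in> spinors b) \<Longrightarrow> (\<Sum>i\<in>I. g i) \<in> spinors b"
  by (induction I rule: infinite_finite_induct) (auto intro: zero_in_spinors add_in_spinors)

lemma subspace_spinors: "subspace (spinors b)"
  by (rule subspaceI) (auto simp: scaleR_eq_scale intro: zero_in_spinors add_in_spinors scale_in_spinors)

text \<open>For even \<open>n\<close> there is no exceptional generator, and toggling one element changes the parity.\<close>

lemma gamma_in_spinors:
  fixes v :: "('n::{finite,linorder}) exterior"
  assumes "v \<in> spinors b"
  shows "clifford_gamma (idx (j :: 'n)) v \<in> spinors (\<not> b)"
  unfolding spinors_def
proof (intro CollectI allI impI)
  fix \<delta> :: "'n set"
  let ?k = "idx j"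
  assume "clifford_gamma ?k v $ \<delta> \<noteq> 0"
  then have "v $ gamma_set ?k \<delta> \<noteq> 0"
    by (auto simp: gamma_nth)
  with assms have sub: "gamma_set ?k \<delta> \<subseteq> elt ` {1..CARD('n) div 2}"
    and par: "even CARD('n) \<Longrightarrow> even (card (gamma_set ?k \<delta>)) = b"
    by (auto simp: spinors_def)
  show "\<delta> \<subseteq> elt ` {1..CARD('n) div 2} \<and> (even CARD('n) \<longrightarrow> even (card \<delta>) = (\<not> b))"
  proof (cases "last_gamma TYPE('n) ?k")
    case True
    with sub show ?thesis by (simp add: gamma_set_def last_gamma_def)
  next
    case False
    have "?k \<in> {1..CARD('n)}" using range_idx by blast
    then have "gamma_elt ?k \<in> (elt ` {1..CARD('n) div 2} :: 'n set)"
      unfolding gamma_elt_def using gamma_elt_range False by blast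
    moreover have "even (card (toggle (gamma_elt ?k) \<delta>)) \<longleftrightarrow> odd (card \<delta>)"
      using card_Suc_Diff1[of \<delta> "gamma_elt ?k"] by (auto simp: toggle_def)
    ultimately show ?thesis
      using False sub par by (auto simp: gamma_set_def toggle_def split: if_splits)
  qed
qed


section \<open>The Dirac operators and the complex\<close>

lemma partial_linear_combination:
  assumes "open \<Omega>" "x \<in> \<Omega>" "\<And>i. clinear (L i)" "\<And>i. smooth_on \<Omega> (h i)"
  shows "partial p (\<lambda>y. \<Sum>i\<in>I. L i (h i y)) x = (\<Sum>i\<in>I. L i (partial p (h i) x))"
proof -
  have d: "h i differentiable (at x)" for i
    by (rule smooth_on_differentiable[OF assms(1,4,2)])
  have "(\<lambda>y. L i (h i y)) differentiable (at x)" for i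
    by (rule smooth_on_differentiable[OF assms(1)
          smooth_on_bounded_linear[OF assms(1) clinear_bounded_linear[OF assms(3)] assms(4)] assms(2)])
  then have "partial p (\<lambda>y. \<Sum>i\<in>I. L i (h i y)) x = (\<Sum>i\<in>I. partial p (\<lambda>y. L i (h i y)) x)"
    by (rule partial_sum)
  also have "\<dots> = (\<Sum>i\<in>I. L i (partial p (h i) x))"
    by (rule sum.cong[OF refl], rule partial_bounded_linear[OF clinear_bounded_linear[OF assms(3)] d])
  finally show ?thesis .
qed

lemma smooth_on_nabla:
  assumes "open \<Omega>" "smooth_on \<Omega> f"
  shows "smooth_on \<Omega> (nabla A f)"
  unfolding nabla_def
  by (rule smooth_on_sum[OF assms(1) finite], rule smooth_on_bounded_linear[OF assms(1)
        clinear_bounded_linear[OF clinear_gamma] smooth_on_partial[OF assms(2)]])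

lemma partial_nabla:
  assumes "open \<Omega>" "smooth_on \<Omega> f" "x \<in> \<Omega>"
  shows "partial p (nabla A f) x = (\<Sum>j\<in>UNIV. clifford_gamma (idx j) (partial p (partial (A, j) f) x))"
  unfolding nabla_def
  by (rule partial_linear_combination[OF assms(1,3) clinear_gamma smooth_on_partial[OF assms(2)]])

lemma nabla_cong:
  assumes "open \<Omega>" "x \<in> \<Omega>" "\<And>y. y \<in> \<Omega> \<Longrightarrow> f y = g y"
  shows "nabla A f x = nabla A g x"
  unfolding nabla_def
  by (intro sum.cong[OF refl] arg_cong[where f = "clifford_gamma _"] partial_cong[OF assms(1,2)])
    (rule assms(3))

lemma nabla_diff:
  assumes "open \<Omega>" "x \<in> \<Omega>" "smooth_on \<Omega> u" "smooth_on \<Omega> v"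
  shows "nabla A (\<lambda>y. u y - v y) x = nabla A u x - nabla A v x"
proof -
  have "partial p (\<lambda>y. u y - v y) x = partial p u x - partial p v x" for p
    using partial_eqI[OF has_derivative_diff[OF
        frechet_derivative_works[THEN iffD1, OF smooth_on_differentiable[OF assms(1,3,2)]]
        frechet_derivative_works[THEN iffD1, OF smooth_on_differentiable[OF assms(1,4,2)]]]]
    by (simp add: partial_def)
  then show ?thesis
    by (simp add: nabla_def linear_diff[OF clinear_linear[OF clinear_gamma]] sum_subtractf)
qed

text \<open>Against a symmetric family only the symmetric part \<open>(\<gamma>\<^sub>j\<gamma>\<^sub>k + \<gamma>\<^sub>k\<gamma>\<^sub>j) / 2 = - \<delta>\<^sub>j\<^sub>k\<close> of
  \<open>\<gamma>\<^sub>j\<gamma>\<^sub>k\<close> survives. With \<open>T\<close> the second derivatives this is \<open>\<nabla>\<^sub>A\<^sup>2 = - \<Delta>\<^sub>A\<close>; with \<open>T\<close> the products of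
  covector components it is the corresponding identity for symbols.\<close>

lemma clifford_sum_symmetric:
  fixes T :: "'n::{finite,linorder} \<Rightarrow> 'n \<Rightarrow> 'n exterior"
  assumes "\<And>j k. T j k = T k j"
  shows "(\<Sum>j\<in>UNIV. clifford_gamma (idx j) (\<Sum>k\<in>UNIV. clifford_gamma (idx k) (T j k)))
    = - (\<Sum>j\<in>UNIV. T j j)"
proof -
  let ?g = "\<lambda>j :: 'n. clifford_gamma (idx j)"
  let ?S = "\<Sum>j\<in>UNIV. \<Sum>k\<in>UNIV. ?g j (?g k (T j k))"
  have "?S = (\<Sum>j\<in>UNIV. \<Sum>k\<in>UNIV. ?g k (?g j (T j k)))"
    by (subst sum.swap) (simp add: assms)
  then have "?S + ?S = (\<Sum>j\<in>UNIV. \<Sum>k\<in>UNIV. ?g j (?g k (T j k)) + ?g k (?g j (T j k)))"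
    by (simp add: sum.distrib)
  also have "\<dots> = (\<Sum>j\<in>UNIV. \<Sum>k\<in>UNIV. if j = k then - 2 *s T j k else 0)"
    unfolding clifford_relation by (intro sum.cong refl) simp
  also have "\<dots> = (- 2) *s (\<Sum>j\<in>UNIV. T j j)"
    by (simp add: vec.scale_sum_right sum.delta)
  finally have "2 *s ?S = 2 *s (- (\<Sum>j\<in>UNIV. T j j))"
    by (simp add: vec_eq_iff)
  then have "?S = - (\<Sum>j\<in>UNIV. T j j)"
    unfolding vec.scale_cancel_left by simp
  then show ?thesis
    by (simp add: clinear_sum[OF clinear_gamma])
qed

definition laplacian :: "2 \<Rightarrow> (('n::{finite,linorder}) point \<Rightarrow> 'n exterior) \<Rightarrow> 'n point \<Rightarrow> 'n exterior" where
  "laplacian A f x = (\<Sum>j\<in>UNIV. partial (A, j) (partial (A, j) f) x)"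

lemma nabla_nabla:
  assumes "open \<Omega>" "smooth_on \<Omega> f" "x \<in> \<Omega>"
  shows "nabla A (nabla A f) x = - laplacian A f x"
  unfolding nabla_def[of A "nabla A f"] partial_nabla[OF assms] laplacian_def
  by (rule clifford_sum_symmetric) (rule partial_commute[OF assms])

lemma partial_laplacian:
  assumes "open \<Omega>" "smooth_on \<Omega> f" "x \<in> \<Omega>"
  shows "partial p (\<lambda>y. - laplacian A f y) x = - laplacian A (partial p f) x"
proof -
  have 1: "partial p (partial q (partial q f)) x = partial q (partial q (partial p f)) x" for q
  proof -
    have "partial p (partial q (partial q f)) x = partial q (partial p (partial q f)) x"
      by (rule partial_commute[OF assms(1) smooth_on_partial[OF assms(2)] assms(3)])
    also have "\<dots> = partial q (partial q (partial p f)) x"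
      by (rule partial_cong[OF assms(1,3) partial_commute[OF assms(1,2)]])
    finally show ?thesis .
  qed
  have L: "clinear (\<lambda>v. - v)" by (rule clinearI) simp_all
  have "partial p (\<lambda>y. \<Sum>j\<in>UNIV. - partial (A, j) (partial (A, j) f) y) x
      = (\<Sum>j\<in>UNIV. - partial p (partial (A, j) (partial (A, j) f)) x)"
    by (rule partial_linear_combination[OF assms(1,3) L smooth_on_partial[OF smooth_on_partial[OF assms(2)]]])
  then show ?thesis
    by (simp add: laplacian_def 1 sum_negf)
qed

lemma laplacian_nabla:
  assumes "open \<Omega>" "smooth_on \<Omega> f" "x \<in> \<Omega>"
  shows "laplacian A (nabla B f) x = (\<Sum>j\<in>UNIV. clifford_gamma (idx j) (laplacian A (partial (B, j) f) x))"
proof -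
  have "partial p (partial p (nabla B f)) x
      = (\<Sum>j\<in>UNIV. clifford_gamma (idx j) (partial p (partial p (partial (B, j) f)) x))" for p
  proof -
    have "partial p (partial p (nabla B f)) x
        = partial p (\<lambda>y. \<Sum>j\<in>UNIV. clifford_gamma (idx j) (partial p (partial (B, j) f) y)) x"
      by (rule partial_cong[OF assms(1,3) partial_nabla[OF assms(1,2)]])
    also have "\<dots> = (\<Sum>j\<in>UNIV. clifford_gamma (idx j) (partial p (partial p (partial (B, j) f)) x))"
      by (rule partial_linear_combination[OF assms(1,3) clinear_gamma
            smooth_on_partial[OF smooth_on_partial[OF assms(2)]]])
    finally show ?thesis .
  qed
  then have "laplacian A (nabla B f) x = (\<Sum>k\<in>UNIV. \<Sum>j\<in>UNIV.
      clifford_gamma (idx j) (partial (A, k) (partial (A, k) (partial (B, j) f)) x))"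
    by (simp add: laplacian_def)
  also have "\<dots> = (\<Sum>j\<in>UNIV. \<Sum>k\<in>UNIV.
      clifford_gamma (idx j) (partial (A, k) (partial (A, k) (partial (B, j) f)) x))"
    by (rule sum.swap)
  finally show ?thesis
    by (simp add: laplacian_def clinear_sum[OF clinear_gamma])
qed

text \<open>\<open>\<nabla>\<^sub>A\<^sup>2 = - \<Delta>\<^sub>A\<close> is a scalar operator with constant coefficients. This is the only
  commutation that the complex needs.\<close>

lemma nabla_commutes_with_square:
  assumes "open \<Omega>" "smooth_on \<Omega> f" "x \<in> \<Omega>"
  shows "nabla B (nabla A (nabla A f)) x = nabla A (nabla A (nabla B f)) x"
proof -
  have "nabla B (nabla A (nabla A f)) x = nabla B (\<lambda>y. - laplacian A f y) x"
    by (rule nabla_cong[OF assms(1,3) nabla_nabla[OF assms(1,2)]])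
  also have "\<dots> = - laplacian A (nabla B f) x"
    unfolding nabla_def[of B "\<lambda>y. - laplacian A f y"] partial_laplacian[OF assms] laplacian_nabla[OF assms]
    by (simp add: linear_neg[OF clinear_linear[OF clinear_gamma]] sum_negf)
  also have "\<dots> = nabla A (nabla A (nabla B f)) x"
    by (rule nabla_nabla[OF assms(1) smooth_on_nabla[OF assms(1,2)] assms(3), symmetric])
  finally show ?thesis .
qed

lemma entry_column [simp]: "entry (column G) A = G A"
  by (simp add: entry_def column_def vec_eq_iff)

lemma exterior2_eqI:
  assumes "\<And>A. entry g A = entry h A"
  shows "g = h"
  unfolding vec_eq_iff
proof
  fix p
  have "entry g (fst p) $ snd p = entry h (fst p) $ snd p"
    by (simp only: assms)
  then show "g $ p = h $ p" by (simp add: entry_def)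
qed

lemma clinear_entry: "clinear (\<lambda>g. entry g A)"
  by (rule clinearI) (simp_all add: entry_def vec_eq_iff)

lemma smooth_on_entry: "open \<Omega> \<Longrightarrow> smooth_on \<Omega> g \<Longrightarrow> smooth_on \<Omega> (\<lambda>y. entry (g y) A)"
  by (rule smooth_on_bounded_linear[OF _ clinear_bounded_linear[OF clinear_entry]])

lemma two_cases: "A = 0 \<or> A = 1" for A :: 2
  using exhaust_2[of A] by auto

text \<open>The component \<open>A\<close> is \<open>\<nabla>\<^sub>0\<nabla>\<^sub>A\<nabla>\<^sub>1 f - \<nabla>\<^sub>1\<nabla>\<^sub>A\<nabla>\<^sub>0 f\<close>; for either value of \<open>A\<close> the index \<open>A\<close> occurs
  twice in a row in both terms.\<close>

lemma D1_D0:
  assumes "open \<Omega>" "smooth_on \<Omega> f" "x \<in> \<Omega>"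
  shows "D1 (D0 f) x = 0"
proof -
  have "nabla 0 (nabla A (nabla 1 f)) x - nabla 1 (nabla A (nabla 0 f)) x = 0" for A
    using two_cases[of A] nabla_commutes_with_square[OF assms, of 1 0]
      nabla_commutes_with_square[OF assms, of 0 1] by auto
  moreover have "(\<lambda>y. entry (D0 f y) A) = nabla A f" for A
    by (simp add: D0_def)
  ultimately show ?thesis
    by (simp add: D1_def column_def vec_eq_iff)
qed

text \<open>The terms in \<open>g\<^sub>1\<close> are \<open>\<nabla>\<^sub>0\<nabla>\<^sub>0\<nabla>\<^sub>1 - \<nabla>\<^sub>1\<nabla>\<^sub>0\<nabla>\<^sub>0\<close> and those in \<open>g\<^sub>0\<close> are
  \<open>\<nabla>\<^sub>1\<nabla>\<^sub>1\<nabla>\<^sub>0 - \<nabla>\<^sub>0\<nabla>\<^sub>1\<nabla>\<^sub>1\<close>.\<close>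

lemma D2_D1:
  assumes "open \<Omega>" "smooth_on \<Omega> g" "x \<in> \<Omega>"
  shows "D2 (D1 g) x = 0"
proof -
  define u v where "u = (\<lambda>y. entry (g y) 1)" and "v = (\<lambda>y. entry (g y) 0)"
  have u: "smooth_on \<Omega> u" and v: "smooth_on \<Omega> v"
    unfolding u_def v_def by (rule smooth_on_entry[OF assms(1,2)])+
  have e: "(\<lambda>y. entry (D1 g y) A) = (\<lambda>y. nabla 0 (nabla A u) y - nabla 1 (nabla A v) y)" for A
    unfolding D1_def entry_column u_def v_def ..
  have d: "nabla B (\<lambda>y. entry (D1 g y) A) x
      = nabla B (nabla 0 (nabla A u)) x - nabla B (nabla 1 (nabla A v)) x" for A B
    unfolding e
    by (rule nabla_diff[OF assms(1,3) smooth_on_nabla[OF assms(1) smooth_on_nabla[OF assms(1) u]]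
          smooth_on_nabla[OF assms(1) smooth_on_nabla[OF assms(1) v]]])
  have "nabla 1 (nabla 0 (nabla 0 u)) x = nabla 0 (nabla 0 (nabla 1 u)) x"
    by (rule nabla_commutes_with_square[OF assms(1) u assms(3)])
  moreover have "nabla 0 (nabla 1 (nabla 1 v)) x = nabla 1 (nabla 1 (nabla 0 v)) x"
    by (rule nabla_commutes_with_square[OF assms(1) v assms(3)])
  ultimately show ?thesis
    unfolding D2_def d by simp
qed


section \<open>The three operators as constant coefficient operators\<close>

lemma smooth_on_word:
  "smooth_on \<Omega> f \<Longrightarrow> smooth_on \<Omega> (foldr partial w f)"
  by (induction w) (simp_all add: smooth_on_partial)

lemma partial_word_in_subspace:
  fixes f :: "('n::finite) point \<Rightarrow> 'b::euclidean_space"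
  assumes "open \<Omega>" "smooth_on \<Omega> f" "subspace V" "f ` \<Omega> \<subseteq> V"
  shows "foldr partial w f ` \<Omega> \<subseteq> V"
proof (induction w)
  case Nil
  then show ?case using assms(4) by simp
next
  case (Cons p w)
  have "partial p (foldr partial w f) x \<in> V" if "x \<in> \<Omega>" for x
    by (rule partial_in_subspace[OF assms(1) that
          smooth_on_differentiable[OF assms(1) smooth_on_word[OF assms(2)] that] assms(3) Cons])
  then show ?case by auto
qed

lemma constant_coefficient_C_inf:
  fixes V :: "(complex ^ 'k::finite) set" and V' :: "(complex ^ 'l::finite) set"
    and \<Omega> :: "('n::finite) point set"
  assumes "open \<Omega>" "\<And>w. clinear (L w)" "subspace V" "subspace V'" "\<And>w u. u \<in> V \<Longrightarrow> L w u \<in> V'"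
    and D: "\<And>f x. f \<in> C_inf \<Omega> V \<Longrightarrow> x \<in> \<Omega> \<Longrightarrow> D f x = (\<Sum>w | length w = r. L w (foldr partial w f x))"
  shows "D ` C_inf \<Omega> V \<subseteq> C_inf \<Omega> V'"
proof (rule image_subsetI)
  fix f assume f: "f \<in> C_inf \<Omega> V"
  then have s: "smooth_on \<Omega> f" and v: "f ` \<Omega> \<subseteq> V"
    by (auto simp: C_inf_iff)
  have fin: "finite {w :: (2 \<times> 'n) list. length w = r}"
    by (rule finite_subset[OF _ finite_words[of r]]) auto
  have "smooth_on \<Omega> (\<lambda>x. \<Sum>w | length w = r. L w (foldr partial w f x))"
    by (rule smooth_on_sum[OF assms(1) fin], rule smooth_on_bounded_linear[OF assms(1)
          clinear_bounded_linear[OF assms(2)] smooth_on_word[OF s]])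
  moreover have "Ck_on k \<Omega> (D f) \<longleftrightarrow> Ck_on k \<Omega> (\<lambda>x. \<Sum>w | length w = r. L w (foldr partial w f x))" for k
    by (rule Ck_on_cong[OF assms(1)]) (rule D[OF f])
  ultimately have "smooth_on \<Omega> (D f)"
    unfolding smooth_on_def by simp
  moreover have "D f x \<in> V'" if "x \<in> \<Omega>" for x
  proof -
    have "foldr partial w f x \<in> V" for w
      by (rule subsetD[OF partial_word_in_subspace[OF assms(1) s assms(3) v] imageI[OF that]])
    then show ?thesis
      unfolding D[OF f that] by (intro subspace_sum[OF assms(4)] assms(5))
  qed
  ultimately show "D f \<in> C_inf \<Omega> V'"
    by (auto simp: C_inf_iff)
qed

lemma sum_labels: "(\<Sum>p\<in>UNIV. F p) = (\<Sum>B\<in>UNIV. \<Sum>j\<in>UNIV. F (B, j))"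
  using sum.cartesian_product[of "\<lambda>B j. F (B, j)" UNIV UNIV] by simp

lemma sum_two: "(\<Sum>B\<in>UNIV. F B) = F 0 + F 1" for F :: "2 \<Rightarrow> 'b::comm_monoid_add"
proof -
  have "(UNIV :: 2 set) = {0, 1}" using two_cases by auto
  then have "sum F UNIV = sum F {0, 1}" by (rule arg_cong)
  then show ?thesis by simp
qed

text \<open>The rotation \<open>(g\<^sub>0, g\<^sub>1) \<mapsto> (g\<^sub>1, - g\<^sub>0)\<close>. It turns the differences in \<open>D1\<close> and \<open>D2\<close> into sums,
  \<open>(D1 g)\<^sub>A = \<Sum>\<^sub>B \<nabla>\<^sub>B \<nabla>\<^sub>A (cross B g)\<close> and \<open>D2 h = \<Sum>\<^sub>B \<nabla>\<^sub>B (cross B h)\<close>, to which coefficients can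
  be assigned word by word.\<close>

definition cross :: "2 \<Rightarrow> ('n::{finite,linorder}) exterior2 \<Rightarrow> 'n exterior" where
  "cross B g = (if B = 0 then entry g 1 else - entry g 0)"

lemma clinear_cross: "clinear (cross B)"
  by (rule clinearI) (simp_all add: cross_def clinear_add[OF clinear_entry] clinear_scale[OF clinear_entry])

text \<open>The symbol of \<open>\<nabla>\<^sub>A\<close> at the covector \<open>\<nu>\<close>.\<close>

definition slash :: "'n point \<Rightarrow> 2 \<Rightarrow> ('n::{finite,linorder}) exterior \<Rightarrow> 'n exterior" where
  "slash \<nu> A v = (\<Sum>j\<in>UNIV. clifford_gamma (idx j) ((complex_of_real (\<nu> $ A $ j) / \<i>) *s v))"

lemma clinear_slash: "clinear (slash \<nu> A)"
  unfolding slash_def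
  by (rule clinear_compose_sum, rule clinear_comp[OF clinear_gamma], rule clinearI)
    (simp_all only: vec.scale_right_distrib vec.scale_left_commute)

lemma slash_in_spinors: "v \<in> spinors b \<Longrightarrow> slash \<nu> A v \<in> spinors (\<not> b)"
  unfolding slash_def by (intro sum_in_spinors gamma_in_spinors scale_in_spinors)

lemma slash_slash:
  "slash \<nu> B (slash \<nu> A v) = (\<Sum>j\<in>UNIV. clifford_gamma (idx j) (\<Sum>k\<in>UNIV. clifford_gamma (idx k)
    ((complex_of_real (\<nu> $ B $ j) / \<i> * (complex_of_real (\<nu> $ A $ k) / \<i>)) *s v)))"
  unfolding slash_def
  by (simp only: vec.scale_sum_right vec.scale_scale clinear_scale[OF clinear_gamma])

text \<open>The factors \<open>1 / \<i>\<close> turn the sign of the Clifford relation into \<open>+\<close>.\<close>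

lemma slash_square: "slash \<nu> A (slash \<nu> A v) = complex_of_real (\<nu> $ A \<bullet> \<nu> $ A) *s v"
proof -
  let ?c = "\<lambda>j. complex_of_real (\<nu> $ A $ j) / \<i>"
  have c: "?c j * ?c j = - complex_of_real (\<nu> $ A $ j * \<nu> $ A $ j)" for j
    by (simp add: field_simps)
  have "slash \<nu> A (slash \<nu> A v) = - (\<Sum>j\<in>UNIV. (?c j * ?c j) *s v)"
    unfolding slash_slash by (rule clifford_sum_symmetric) (simp add: mult.commute)
  also have "\<dots> = (\<Sum>j\<in>UNIV. complex_of_real (\<nu> $ A $ j * \<nu> $ A $ j)) *s v"
    unfolding c by (simp add: vec.scale_sum_left sum_negf)
  finally show ?thesis by (simp add: inner_vec_def)
qed

text \<open>Coefficients of the words \<open>[p]\<close> or \<open>[p, q]\<close>, written with \<open>hd\<close> and \<open>tl\<close> so that they are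
  defined, and linear, for every word. In \<open>D1_coeff\<close> the first label belongs to the outer
  operator \<open>\<nabla>\<^sub>B\<close>.\<close>

definition D0_coeff :: "(2 \<times> 'n) list \<Rightarrow> ('n::{finite,linorder}) exterior \<Rightarrow> 'n exterior2" where
  "D0_coeff w u = column (\<lambda>A. if A = fst (hd w) then clifford_gamma (idx (snd (hd w))) u else 0)"

definition D1_coeff :: "(2 \<times> 'n) list \<Rightarrow> ('n::{finite,linorder}) exterior2 \<Rightarrow> 'n exterior2" where
  "D1_coeff w u = column (\<lambda>A. if A = fst (hd (tl w)) then
     clifford_gamma (idx (snd (hd w))) (clifford_gamma (idx (snd (hd (tl w)))) (cross (fst (hd w)) u)) else 0)"

definition D2_coeff :: "(2 \<times> 'n) list \<Rightarrow> ('n::{finite,linorder}) exterior2 \<Rightarrow> 'n exterior" where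
  "D2_coeff w u = clifford_gamma (idx (snd (hd w))) (cross (fst (hd w)) u)"

lemma clinear_column:
  assumes "\<And>A. clinear (\<lambda>u. F u A)"
  shows "clinear (\<lambda>u. column (F u))"
  by (rule clinearI; rule exterior2_eqI)
    (simp_all only: entry_column clinear_add[OF assms] clinear_scale[OF assms]
      clinear_add[OF clinear_entry] clinear_scale[OF clinear_entry])

lemma clinear_zero: "clinear (\<lambda>u. 0)"
  by (rule clinearI) simp_all

lemma clinear_if: "clinear F \<Longrightarrow> clinear (\<lambda>u. if P then F u else 0)"
  using clinear_zero by (cases P) simp_all

lemma clinear_coeffs: "clinear (D0_coeff w)" "clinear (D1_coeff w)" "clinear (D2_coeff w)"
proof -
  have c: "clinear (\<lambda>u. clifford_gamma k (cross B u))" for k B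
    by (rule clinear_comp[OF clinear_gamma clinear_cross])
  show "clinear (D0_coeff w)"
    unfolding D0_coeff_def by (rule clinear_column, rule clinear_if, rule clinear_gamma)
  show "clinear (D1_coeff w)"
    unfolding D1_coeff_def
    by (rule clinear_column, rule clinear_if, rule clinear_comp[OF clinear_gamma c])
  show "clinear (D2_coeff w)"
    unfolding D2_coeff_def by (rule c)
qed

lemma sum_words_1: "(\<Sum>w | length w = 1. G w) = (\<Sum>B\<in>UNIV. \<Sum>j\<in>UNIV. G [(B, j)])"
  for G :: "('a::finite \<times> 'b::finite) list \<Rightarrow> 'c::comm_monoid_add"
  using sum_words_Suc[of G 0] by (simp add: sum_labels)

lemma sum_words_2: "(\<Sum>w | length w = 2. G w) =
    (\<Sum>B\<in>UNIV. \<Sum>j\<in>UNIV. \<Sum>A\<in>UNIV. \<Sum>k\<in>UNIV. G [(B, j), (A, k)])"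
  for G :: "('a::finite \<times> 'b::finite) list \<Rightarrow> 'c::comm_monoid_add"
  using sum_words_Suc[of G 1] by (simp add: sum_labels sum_words_1[unfolded One_nat_def] numeral_2_eq_2)

text \<open>The sums are evaluated for an arbitrary family \<open>T\<close>: derivatives of a function give the operators,
  and multiples of one vector by monomials in \<open>\<nu>\<close> give their symbols.\<close>

lemma D0_coeff_sum:
  "entry (\<Sum>w | length w = 1. D0_coeff w (T w)) A = (\<Sum>j\<in>UNIV. clifford_gamma (idx j) (T [(A, j)]))"
proof -
  have "entry (\<Sum>w | length w = 1. D0_coeff w (T w)) A
      = (\<Sum>B\<in>UNIV. \<Sum>j\<in>UNIV. if A = B then clifford_gamma (idx j) (T [(B, j)]) else 0)"
    unfolding sum_words_1 clinear_sum[OF clinear_entry] by (simp add: D0_coeff_def cong: if_cong)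
  also have "\<dots> = (\<Sum>B\<in>UNIV. if A = B then \<Sum>j\<in>UNIV. clifford_gamma (idx j) (T [(B, j)]) else 0)"
    by (rule sum.cong) auto
  finally show ?thesis by simp
qed

lemma D1_coeff_sum:
  "entry (\<Sum>w | length w = 2. D1_coeff w (T w)) A = (\<Sum>B\<in>UNIV. \<Sum>j\<in>UNIV. clifford_gamma (idx j)
     (\<Sum>k\<in>UNIV. clifford_gamma (idx k) (cross B (T [(B, j), (A, k)]))))"
proof -
  let ?t = "\<lambda>B j C k. clifford_gamma (idx j) (clifford_gamma (idx k) (cross B (T [(B, j), (C, k)])))"
  have "entry (\<Sum>w | length w = 2. D1_coeff w (T w)) A
      = (\<Sum>B\<in>UNIV. \<Sum>j\<in>UNIV. \<Sum>C\<in>UNIV. \<Sum>k\<in>UNIV. if A = C then ?t B j C k else 0)"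
    unfolding sum_words_2 clinear_sum[OF clinear_entry] by (simp add: D1_coeff_def cong: if_cong)
  also have "\<dots> = (\<Sum>B\<in>UNIV. \<Sum>j\<in>UNIV. \<Sum>C\<in>UNIV. if A = C then \<Sum>k\<in>UNIV. ?t B j C k else 0)"
    by (intro sum.cong) auto
  finally show ?thesis by (simp add: clinear_sum[OF clinear_gamma])
qed

lemma D2_coeff_sum:
  "(\<Sum>w | length w = 1. D2_coeff w (T w)) =
    (\<Sum>B\<in>UNIV. \<Sum>j\<in>UNIV. clifford_gamma (idx j) (cross B (T [(B, j)])))"
  unfolding sum_words_1 by (simp add: D2_coeff_def)

lemma D0_expansion: "D0 f x = (\<Sum>w | length w = 1. D0_coeff w (foldr partial w f x))"
  by (rule exterior2_eqI) (simp only: D0_coeff_sum, simp add: D0_def nabla_def)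

lemma partial_cross:
  assumes "open \<Omega>" "smooth_on \<Omega> g" "x \<in> \<Omega>"
  shows "partial p (\<lambda>y. cross B (g y)) x = cross B (partial p g x)"
  by (rule partial_bounded_linear[OF clinear_bounded_linear[OF clinear_cross]
        smooth_on_differentiable[OF assms]])

lemma smooth_on_cross: "open \<Omega> \<Longrightarrow> smooth_on \<Omega> g \<Longrightarrow> smooth_on \<Omega> (\<lambda>y. cross B (g y))"
  by (rule smooth_on_bounded_linear[OF _ clinear_bounded_linear[OF clinear_cross]])

lemma nabla_uminus:
  assumes "open \<Omega>" "smooth_on \<Omega> u" "x \<in> \<Omega>"
  shows "nabla A (\<lambda>y. - u y) x = - nabla A u x"
proof -
  have "partial p (\<lambda>y. - u y) x = - partial p u x" for p
    by (rule partial_bounded_linear[OF bounded_linear_minus[OF bounded_linear_ident]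
          smooth_on_differentiable[OF assms]])
  then show ?thesis
    by (simp add: nabla_def linear_neg[OF clinear_linear[OF clinear_gamma]] sum_negf)
qed

lemma D2_expansion:
  assumes "open \<Omega>" "smooth_on \<Omega> h" "x \<in> \<Omega>"
  shows "D2 h x = (\<Sum>w | length w = 1. D2_coeff w (foldr partial w h x))"
proof -
  have "D2 h x = (\<Sum>B\<in>UNIV. nabla B (\<lambda>y. cross B (h y)) x)"
    by (simp add: D2_def sum_two cross_def nabla_uminus[OF assms(1) smooth_on_entry[OF assms(1,2)] assms(3)])
  also have "\<dots> = (\<Sum>w | length w = 1. D2_coeff w (foldr partial w h x))"
    unfolding D2_coeff_sum by (simp add: nabla_def partial_cross[OF assms])
  finally show ?thesis .
qed

lemma D1_expansion:
  assumes "open \<Omega>" "smooth_on \<Omega> g" "x \<in> \<Omega>"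
  shows "D1 g x = (\<Sum>w | length w = 2. D1_coeff w (foldr partial w g x))"
proof (rule exterior2_eqI)
  fix A :: 2
  have e: "smooth_on \<Omega> (\<lambda>y. entry (g y) C)" for C
    by (rule smooth_on_entry[OF assms(1,2)])
  have "nabla 1 (nabla A (\<lambda>y. - entry (g y) 0)) x = nabla 1 (\<lambda>y. - nabla A (\<lambda>y. entry (g y) 0) y) x"
    by (rule nabla_cong[OF assms(1,3) nabla_uminus[OF assms(1) e]])
  also have "\<dots> = - nabla 1 (nabla A (\<lambda>y. entry (g y) 0)) x"
    by (rule nabla_uminus[OF assms(1) smooth_on_nabla[OF assms(1) e] assms(3)])
  finally have "entry (D1 g x) A = (\<Sum>B\<in>UNIV. nabla B (nabla A (\<lambda>y. cross B (g y))) x)"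
    by (simp add: D1_def sum_two cross_def)
  also have "\<dots> = (\<Sum>B\<in>UNIV. \<Sum>j\<in>UNIV. clifford_gamma (idx j)
     (\<Sum>k\<in>UNIV. clifford_gamma (idx k) (partial (B, j) (partial (A, k) (\<lambda>y. cross B (g y))) x)))"
    unfolding nabla_def[of _ "nabla A _"] partial_nabla[OF assms(1) smooth_on_cross[OF assms(1,2)] assms(3)] ..
  also have "\<dots> = entry (\<Sum>w | length w = 2. D1_coeff w (foldr partial w g x)) A"
  proof -
    have "partial p (partial q (\<lambda>y. cross B (g y))) x = cross B (partial p (partial q g) x)" for p q B
    proof -
      have "partial p (partial q (\<lambda>y. cross B (g y))) x = partial p (\<lambda>y. cross B (partial q g y)) x"
        by (rule partial_cong[OF assms(1,3) partial_cross[OF assms(1,2)]])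
      also have "\<dots> = cross B (partial p (partial q g) x)"
        by (rule partial_cross[OF assms(1) smooth_on_partial[OF assms(2)] assms(3)])
      finally show ?thesis .
    qed
    then show ?thesis by (simp add: D1_coeff_sum)
  qed
  finally show "entry (D1 g x) A = entry (\<Sum>w | length w = 2. D1_coeff w (foldr partial w g x)) A" .
qed

definition symbol_0 :: "'n point \<Rightarrow> ('n::{finite,linorder}) exterior \<Rightarrow> 'n exterior2" where
  "symbol_0 \<nu> f = column (\<lambda>A. slash \<nu> A f)"

definition symbol_1 :: "'n point \<Rightarrow> ('n::{finite,linorder}) exterior2 \<Rightarrow> 'n exterior2" where
  "symbol_1 \<nu> g = column (\<lambda>A. slash \<nu> 0 (slash \<nu> A (entry g 1)) - slash \<nu> 1 (slash \<nu> A (entry g 0)))"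

definition symbol_2 :: "'n point \<Rightarrow> ('n::{finite,linorder}) exterior2 \<Rightarrow> 'n exterior" where
  "symbol_2 \<nu> h = slash \<nu> 0 (entry h 1) - slash \<nu> 1 (entry h 0)"

lemma symbol_sums:
  shows "(\<Sum>w | length w = 1. (\<Prod>(A, j)\<leftarrow>w. complex_of_real (\<nu> $ A $ j) / \<i>) *s D0_coeff w f) = symbol_0 \<nu> f"
    and "(\<Sum>w | length w = 2. (\<Prod>(A, j)\<leftarrow>w. complex_of_real (\<nu> $ A $ j) / \<i>) *s D1_coeff w g) = symbol_1 \<nu> g"
    and "(\<Sum>w | length w = 1. (\<Prod>(A, j)\<leftarrow>w. complex_of_real (\<nu> $ A $ j) / \<i>) *s D2_coeff w h) = symbol_2 \<nu> h"
proof -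
  let ?c = "\<lambda>w. \<Prod>(A, j)\<leftarrow>w. complex_of_real (\<nu> $ A $ j) / \<i>"
  show "(\<Sum>w | length w = 1. ?c w *s D0_coeff w f) = symbol_0 \<nu> f"
    unfolding clinear_scale[OF clinear_coeffs(1), symmetric]
    by (rule exterior2_eqI) (simp only: D0_coeff_sum, simp add: symbol_0_def slash_def)
  show "(\<Sum>w | length w = 2. ?c w *s D1_coeff w g) = symbol_1 \<nu> g"
  proof (rule exterior2_eqI)
    fix A :: 2
    have neg: "slash \<nu> B (- v) = - slash \<nu> B v" for B v
      by (rule linear_neg[OF clinear_linear[OF clinear_slash]])
    have "entry (\<Sum>w | length w = 2. ?c w *s D1_coeff w g) A
        = (\<Sum>B\<in>UNIV. slash \<nu> B (slash \<nu> A (cross B g)))"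
      unfolding clinear_scale[OF clinear_coeffs(2), symmetric] D1_coeff_sum
      by (simp only: slash_slash clinear_scale[OF clinear_cross] list.map prod_list.Cons prod_list.Nil
          case_prod_conv mult_1_right)
    also have "\<dots> = entry (symbol_1 \<nu> g) A"
      by (simp add: symbol_1_def sum_two cross_def neg)
    finally show "entry (\<Sum>w | length w = 2. ?c w *s D1_coeff w g) A = entry (symbol_1 \<nu> g) A" .
  qed
  have neg: "slash \<nu> B (- v) = - slash \<nu> B v" for B v
    by (rule linear_neg[OF clinear_linear[OF clinear_slash]])
  have "(\<Sum>w | length w = 1. ?c w *s D2_coeff w h) = (\<Sum>B\<in>UNIV. slash \<nu> B (cross B h))"
    unfolding clinear_scale[OF clinear_coeffs(3), symmetric] D2_coeff_sum
    by (simp only: slash_def clinear_scale[OF clinear_cross] list.map prod_list.Cons prod_list.Nil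
        case_prod_conv mult_1_right)
  also have "\<dots> = symbol_2 \<nu> h"
    by (simp add: symbol_2_def sum_two cross_def neg)
  finally show "(\<Sum>w | length w = 1. ?c w *s D2_coeff w h) = symbol_2 \<nu> h" .
qed


section \<open>Exactness of the symbol sequence\<close>

lemma subspace_V: "subspace V0" "subspace V1" "subspace V2" "subspace V3"
proof -
  have "subspace {g. \<forall>A. entry g A \<in> spinors b}" for b
  proof (intro subspaceI CollectI allI)
    note lin = clinear_linear[OF clinear_entry]
    show "entry 0 A \<in> spinors b" for A
      unfolding linear_0[OF lin] by (rule zero_in_spinors)
    show "entry (g + h) A \<in> spinors b"
      if "g \<in> {g. \<forall>A. entry g A \<in> spinors b}" "h \<in> {g. \<forall>A. entry g A \<in> spinors b}" for g h A
      unfolding linear_add[OF lin] using that by (simp add: add_in_spinors)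
    show "entry (c *\<^sub>R g) A \<in> spinors b" if "g \<in> {g. \<forall>A. entry g A \<in> spinors b}" for c g A
      unfolding linear_cmul[OF lin] using that by (simp add: subspace_mul[OF subspace_spinors])
  qed
  then show "subspace V0" "subspace V1" "subspace V2" "subspace V3"
    by (simp_all add: V0_def V1_def V2_def V3_def S_plus_eq_spinors S_minus_eq_spinors subspace_spinors)
qed

lemma mem_V:
  "f \<in> V0 \<longleftrightarrow> f \<in> spinors True" "g \<in> V1 \<longleftrightarrow> (\<forall>A. entry g A \<in> spinors False)"
  "h \<in> V2 \<longleftrightarrow> (\<forall>A. entry h A \<in> spinors False)" "u \<in> V3 \<longleftrightarrow> u \<in> spinors True"
  by (simp_all add: V0_def V1_def V2_def V3_def S_plus_eq_spinors S_minus_eq_spinors)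

lemma neg_in_spinors: "v \<in> spinors b \<Longrightarrow> - v \<in> spinors b"
  by (rule subspace_neg[OF subspace_spinors])

lemma diff_in_spinors: "u \<in> spinors b \<Longrightarrow> v \<in> spinors b \<Longrightarrow> u - v \<in> spinors b"
  by (rule subspace_diff[OF subspace_spinors])

lemma cross_in_spinors: "\<forall>A. entry g A \<in> spinors b \<Longrightarrow> cross B g \<in> spinors b"
  by (simp add: cross_def neg_in_spinors)

lemmas slash_parity = slash_in_spinors[of _ True, simplified] slash_in_spinors[of _ False, simplified]

lemmas gamma_parity = gamma_in_spinors[of _ True, simplified] gamma_in_spinors[of _ False, simplified]

lemma coeff_in_V:
  "f \<in> V0 \<Longrightarrow> D0_coeff w f \<in> V1" "g \<in> V1 \<Longrightarrow> D1_coeff w g \<in> V2" "h \<in> V2 \<Longrightarrow> D2_coeff w h \<in> V3"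
  by (simp_all add: mem_V D0_coeff_def D1_coeff_def D2_coeff_def zero_in_spinors gamma_parity
      cross_in_spinors)

lemma symbol_in_V:
  "f \<in> V0 \<Longrightarrow> symbol_0 \<nu> f \<in> V1" "g \<in> V1 \<Longrightarrow> symbol_1 \<nu> g \<in> V2" "h \<in> V2 \<Longrightarrow> symbol_2 \<nu> h \<in> V3"
  by (simp_all add: mem_V symbol_0_def symbol_1_def symbol_2_def slash_parity diff_in_spinors)

lemma slash_inverse:
  assumes "\<nu> $ A \<noteq> 0"
  shows "slash \<nu> A (slash \<nu> A (inverse (complex_of_real (\<nu> $ A \<bullet> \<nu> $ A)) *s v)) = v"
  using assms by (simp add: slash_square)

text \<open>As for the operators: \<open>s\<^sub>A\<^sup>2\<close> is a scalar, so it commutes with \<open>s\<^sub>B\<close>.\<close>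

lemma symbol_compositions: "symbol_1 \<nu> (symbol_0 \<nu> f) = 0" "symbol_2 \<nu> (symbol_1 \<nu> g) = 0"
proof -
  have c: "slash \<nu> B (slash \<nu> A (slash \<nu> A v)) = slash \<nu> A (slash \<nu> A (slash \<nu> B v))" for A B v
    by (simp add: slash_square clinear_scale[OF clinear_slash])
  have "slash \<nu> 0 (slash \<nu> A (slash \<nu> 1 f)) = slash \<nu> 1 (slash \<nu> A (slash \<nu> 0 f))" for A
    using two_cases[of A] c[of 1 0 f] c[of 0 1 f] by auto
  then show "symbol_1 \<nu> (symbol_0 \<nu> f) = 0"
    by (intro exterior2_eqI)
      (simp add: symbol_1_def symbol_0_def linear_0[OF clinear_linear[OF clinear_entry]])
  show "symbol_2 \<nu> (symbol_1 \<nu> g) = 0"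
    using c[of 1 0 "entry g 1"] c[of 0 1 "entry g 0"]
    by (simp add: symbol_2_def symbol_1_def linear_diff[OF clinear_linear[OF clinear_slash]])
qed

text \<open>One invertible \<open>s\<^sub>A\<close> is enough.\<close>

lemma inj_symbol_0:
  assumes "\<nu> \<noteq> 0"
  shows "inj (symbol_0 \<nu>)"
proof (rule injI)
  fix u v assume eq: "symbol_0 \<nu> u = symbol_0 \<nu> v"
  obtain A where A: "\<nu> $ A \<noteq> 0" using assms by (auto simp: vec_eq_iff[of \<nu>])
  have "slash \<nu> A u = slash \<nu> A v"
    using arg_cong[OF eq, of "\<lambda>g. entry g A"] by (simp add: symbol_0_def)
  then have "slash \<nu> A (slash \<nu> A u) = slash \<nu> A (slash \<nu> A v)" by simp
  with A show "u = v" by (simp add: slash_square)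
qed

text \<open>If \<open>s\<^sub>A\<close> is invertible, \<open>f = s\<^sub>A\<^sup>-\<^sup>1 g\<^sub>A\<close> is the only candidate. The equation of the kernel with index
  \<open>A\<close> reads \<open>s\<^sub>B s\<^sub>A g\<^sub>A = s\<^sub>A\<^sup>2 g\<^sub>B\<close> for \<open>B \<noteq> A\<close>, which says \<open>s\<^sub>B f = g\<^sub>B\<close>.\<close>

lemma symbol_1_kernel:
  assumes "\<nu> \<noteq> 0" "g \<in> V1" "symbol_1 \<nu> g = 0"
  shows "g \<in> symbol_0 \<nu> ` V0"
proof -
  have eq: "slash \<nu> 0 (slash \<nu> A (entry g 1)) = slash \<nu> 1 (slash \<nu> A (entry g 0))" for A
    using arg_cong[OF assms(3), of "\<lambda>g. entry g A"]
    by (simp add: symbol_1_def linear_0[OF clinear_linear[OF clinear_entry]])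
  obtain A where A: "\<nu> $ A \<noteq> 0" using assms by (auto simp: vec_eq_iff[of \<nu>])
  define c where "c = inverse (complex_of_real (\<nu> $ A \<bullet> \<nu> $ A))"
  define f where "f = c *s slash \<nu> A (entry g A)"
  have f: "slash \<nu> B f = c *s slash \<nu> B (slash \<nu> A (entry g A))" for B
    by (simp add: f_def clinear_scale[OF clinear_slash])
  have "slash \<nu> B (slash \<nu> A (entry g A)) = slash \<nu> A (slash \<nu> A (entry g B))" for B
    using two_cases[of A] two_cases[of B] eq[of 0] eq[of 1] by auto
  then have "slash \<nu> B f = entry g B" for B
    using slash_inverse[OF A] by (simp add: f c_def clinear_scale[OF clinear_slash])
  then have "g = symbol_0 \<nu> f"
    by (intro exterior2_eqI) (simp add: symbol_0_def)
  moreover have "f \<in> V0"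
    using assms(2) by (simp add: mem_V f_def scale_in_spinors slash_parity)
  ultimately show ?thesis by blast
qed

text \<open>If \<open>\<nu>\<^sub>0 \<noteq> 0\<close>, then \<open>g = (0, |\<nu>\<^sub>0|\<^sup>-\<^sup>2 h\<^sub>0)\<close> is mapped to \<open>h\<close>: the first entry of its image is
  \<open>|\<nu>\<^sub>0|\<^sup>-\<^sup>2 s\<^sub>0\<^sup>2 h\<^sub>0\<close>, and in the second \<open>s\<^sub>0 s\<^sub>1 h\<^sub>0 = s\<^sub>0\<^sup>2 h\<^sub>1\<close> by the equation of the kernel. The
  other case exchanges the two entries, up to sign.\<close>

lemma symbol_2_kernel:
  assumes "\<nu> \<noteq> 0" "h \<in> V2" "symbol_2 \<nu> h = 0"
  shows "h \<in> symbol_1 \<nu> ` V1"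
proof -
  have eq: "slash \<nu> 0 (entry h 1) = slash \<nu> 1 (entry h 0)"
    using assms(3) by (simp add: symbol_2_def)
  have z: "slash \<nu> B 0 = 0" for B
    by (rule linear_0[OF clinear_linear[OF clinear_slash]])
  have neg: "slash \<nu> B (- v) = - slash \<nu> B v" for B v
    by (rule linear_neg[OF clinear_linear[OF clinear_slash]])
  show ?thesis
  proof (cases "\<nu> $ 0 = 0")
    case False
    define c where "c = inverse (complex_of_real (\<nu> $ 0 \<bullet> \<nu> $ 0))"
    define g where "g = column (\<lambda>A. if A = 0 then 0 else c *s entry h 0)"
    have "slash \<nu> 0 (slash \<nu> 1 (c *s entry h 0)) = slash \<nu> 0 (slash \<nu> 0 (c *s entry h 1))"
      by (simp add: clinear_scale[OF clinear_slash] eq)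
    then have "entry (symbol_1 \<nu> g) A = entry h A" for A
      using two_cases[of A] slash_inverse[OF False]
      by (auto simp: symbol_1_def g_def z c_def)
    moreover have "g \<in> V1"
      using assms(2) by (simp add: mem_V g_def zero_in_spinors scale_in_spinors)
    ultimately show ?thesis
      by (intro image_eqI[of h "symbol_1 \<nu>" g] exterior2_eqI) simp_all
  next
    case True
    obtain B where B: "\<nu> $ B \<noteq> 0" using assms(1) by (auto simp: vec_eq_iff[of \<nu>])
    with True have ne: "\<nu> $ 1 \<noteq> 0" using two_cases[of B] by auto
    define c where "c = inverse (complex_of_real (\<nu> $ 1 \<bullet> \<nu> $ 1))"
    define g where "g = column (\<lambda>A. if A = 0 then - (c *s entry h 1) else 0)"
    have "slash \<nu> 1 (slash \<nu> 0 (c *s entry h 1)) = slash \<nu> 1 (slash \<nu> 1 (c *s entry h 0))"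
      by (simp add: clinear_scale[OF clinear_slash] eq)
    then have "entry (symbol_1 \<nu> g) A = entry h A" for A
      using two_cases[of A] slash_inverse[OF ne]
      by (auto simp: symbol_1_def g_def z neg c_def)
    moreover have "g \<in> V1"
      using assms(2) by (simp add: mem_V g_def zero_in_spinors scale_in_spinors neg_in_spinors)
    ultimately show ?thesis
      by (intro image_eqI[of h "symbol_1 \<nu>" g] exterior2_eqI) simp_all
  qed
qed

text \<open>The entry that carries \<open>\<plusminus> s\<^sub>A\<^sup>-\<^sup>1 u\<close> is the one whose index differs from \<open>A\<close>, because \<open>s\<^sub>0\<close> acts
  on \<open>h\<^sub>1\<close> and \<open>s\<^sub>1\<close> on \<open>h\<^sub>0\<close>.\<close>

lemma symbol_2_surj:
  assumes "\<nu> \<noteq> 0" "u \<in> V3"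
  shows "u \<in> symbol_2 \<nu> ` V2"
proof -
  have z: "slash \<nu> B 0 = 0" for B
    by (rule linear_0[OF clinear_linear[OF clinear_slash]])
  have neg: "slash \<nu> B (- v) = - slash \<nu> B v" for B v
    by (rule linear_neg[OF clinear_linear[OF clinear_slash]])
  obtain A where A: "\<nu> $ A \<noteq> 0" using assms by (auto simp: vec_eq_iff[of \<nu>])
  define w where "w = slash \<nu> A (inverse (complex_of_real (\<nu> $ A \<bullet> \<nu> $ A)) *s u)"
  define h where "h = column (\<lambda>B. if B = A then 0 else if A = 0 then w else - w)"
  have "slash \<nu> A w = u"
    unfolding w_def by (rule slash_inverse[OF A])
  then have "symbol_2 \<nu> h = u"
    using two_cases[of A] by (auto simp: symbol_2_def h_def z neg)
  moreover have "w \<in> spinors False"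
    using assms(2) by (simp add: w_def mem_V scale_in_spinors slash_parity)
  then have "h \<in> V2"
    by (simp add: mem_V h_def zero_in_spinors neg_in_spinors)
  ultimately show ?thesis by blast
qed

lemma symbol_sequence_exact:
  assumes "\<nu> \<noteq> 0"
  shows "symbol_0 \<nu> ` V0 = {u \<in> V1. symbol_1 \<nu> u = 0}"
    and "symbol_1 \<nu> ` V1 = {u \<in> V2. symbol_2 \<nu> u = 0}"
    and "symbol_2 \<nu> ` V2 = V3"
proof -
  show "symbol_0 \<nu> ` V0 = {u \<in> V1. symbol_1 \<nu> u = 0}"
  proof (intro subset_antisym subsetI)
    show "u \<in> symbol_0 \<nu> ` V0" if "u \<in> {u \<in> V1. symbol_1 \<nu> u = 0}" for u
      using that by (intro symbol_1_kernel[OF assms]) simp_all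
  qed (clarsimp simp: symbol_in_V symbol_compositions)
  show "symbol_1 \<nu> ` V1 = {u \<in> V2. symbol_2 \<nu> u = 0}"
  proof (intro subset_antisym subsetI)
    show "u \<in> symbol_1 \<nu> ` V1" if "u \<in> {u \<in> V2. symbol_2 \<nu> u = 0}" for u
      using that by (intro symbol_2_kernel[OF assms]) simp_all
  qed (clarsimp simp: symbol_in_V symbol_compositions)
  show "symbol_2 \<nu> ` V2 = V3"
  proof (intro subset_antisym subsetI)
    show "u \<in> symbol_2 \<nu> ` V2" if "u \<in> V3" for u
      by (rule symbol_2_surj[OF assms that])
  qed (clarsimp simp: symbol_in_V)
qed

lemma C_inf_smooth: "f \<in> C_inf \<Omega> V \<Longrightarrow> smooth_on \<Omega> f"
  by (simp add: C_inf_iff)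

lemma diff_ops:
  assumes "open \<Omega>"
  shows "diff_op \<Omega> V0 1 D0" "diff_op \<Omega> V1 2 D1" "diff_op \<Omega> V2 1 D2"
proof -
  show "diff_op \<Omega> V0 1 D0"
    by (rule constant_coefficient_operator(1)[where L = D0_coeff, OF clinear_coeffs(1) D0_expansion])
  show "diff_op \<Omega> V1 2 D1"
    by (rule constant_coefficient_operator(1)[where L = D1_coeff, OF clinear_coeffs(2)])
      (rule D1_expansion[OF assms C_inf_smooth])
  show "diff_op \<Omega> V2 1 D2"
    by (rule constant_coefficient_operator(1)[where L = D2_coeff, OF clinear_coeffs(3)])
      (rule D2_expansion[OF assms C_inf_smooth])
qed

lemma C_inf_maps:
  assumes "open \<Omega>"
  shows "D0 ` C_inf \<Omega> V0 \<subseteq> C_inf \<Omega> V1" "D1 ` C_inf \<Omega> V1 \<subseteq> C_inf \<Omega> V2" "D2 ` C_inf \<Omega> V2 \<subseteq> C_inf \<Omega> V3"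
proof -
  show "D0 ` C_inf \<Omega> V0 \<subseteq> C_inf \<Omega> V1"
    by (rule constant_coefficient_C_inf[where L = D0_coeff and r = 1, OF assms(1) clinear_coeffs(1) subspace_V(1,2)])
      (rule coeff_in_V(1), assumption, rule D0_expansion)
  show "D1 ` C_inf \<Omega> V1 \<subseteq> C_inf \<Omega> V2"
    by (rule constant_coefficient_C_inf[where L = D1_coeff and r = 2, OF assms(1) clinear_coeffs(2) subspace_V(2,3)])
      (rule coeff_in_V(2), assumption, rule D1_expansion[OF assms C_inf_smooth])
  show "D2 ` C_inf \<Omega> V2 \<subseteq> C_inf \<Omega> V3"
    by (rule constant_coefficient_C_inf[where L = D2_coeff and r = 1, OF assms(1) clinear_coeffs(3) subspace_V(3,4)])
      (rule coeff_in_V(3), assumption, rule D2_expansion[OF assms C_inf_smooth])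
qed

lemma symbol_D0:
  assumes "x \<in> \<Omega>" "u \<in> V0"
  shows "symbol \<Omega> V0 1 D0 x \<nu> u = symbol_0 \<nu> u"
proof -
  have "symbol \<Omega> V0 1 D0 x \<nu> u
      = (\<Sum>w | length w = 1. (\<Prod>(A, j)\<leftarrow>w. complex_of_real (\<nu> $ A $ j) / \<i>) *s D0_coeff w u)"
  proof (rule constant_coefficient_operator(2)[where \<Omega> = \<Omega> and V = V0 and D = D0 and L = D0_coeff])
    show "D0 g y = (\<Sum>w | length w = 1. D0_coeff w (foldr partial w g y))"
      if "g \<in> C_inf \<Omega> V0" "y \<in> \<Omega>" for g y
      by (rule D0_expansion)
  qed (rule clinear_coeffs subspace_V assms)+
  then show ?thesis by (simp only: symbol_sums)
qed

lemma symbol_D1: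
  assumes "open \<Omega>" "x \<in> \<Omega>" "u \<in> V1"
  shows "symbol \<Omega> V1 2 D1 x \<nu> u = symbol_1 \<nu> u"
proof -
  have "symbol \<Omega> V1 2 D1 x \<nu> u
      = (\<Sum>w | length w = 2. (\<Prod>(A, j)\<leftarrow>w. complex_of_real (\<nu> $ A $ j) / \<i>) *s D1_coeff w u)"
  proof (rule constant_coefficient_operator(2)[where \<Omega> = \<Omega> and V = V1 and D = D1 and L = D1_coeff])
    show "D1 g y = (\<Sum>w | length w = 2. D1_coeff w (foldr partial w g y))"
      if "g \<in> C_inf \<Omega> V1" "y \<in> \<Omega>" for g y
      by (rule D1_expansion[OF assms(1) C_inf_smooth[OF that(1)] that(2)])
  qed (rule clinear_coeffs subspace_V assms)+
  then show ?thesis by (simp only: symbol_sums)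
qed

lemma symbol_D2:
  assumes "open \<Omega>" "x \<in> \<Omega>" "u \<in> V2"
  shows "symbol \<Omega> V2 1 D2 x \<nu> u = symbol_2 \<nu> u"
proof -
  have "symbol \<Omega> V2 1 D2 x \<nu> u
      = (\<Sum>w | length w = 1. (\<Prod>(A, j)\<leftarrow>w. complex_of_real (\<nu> $ A $ j) / \<i>) *s D2_coeff w u)"
  proof (rule constant_coefficient_operator(2)[where \<Omega> = \<Omega> and V = V2 and D = D2 and L = D2_coeff])
    show "D2 g y = (\<Sum>w | length w = 1. D2_coeff w (foldr partial w g y))"
      if "g \<in> C_inf \<Omega> V2" "y \<in> \<Omega>" for g y
      by (rule D2_expansion[OF assms(1) C_inf_smooth[OF that(1)] that(2)])
  qed (rule clinear_coeffs subspace_V assms)+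
  then show ?thesis by (simp only: symbol_sums)
qed

theorem theorem2p2:
  fixes \<Omega> :: "('n::{finite,linorder}) point set"
  assumes "open \<Omega>" and "connected \<Omega>" and "\<Omega> \<noteq> {}"
  shows
    "diff_op \<Omega> V0 1 D0 \<and> diff_op \<Omega> V1 2 D1 \<and> diff_op \<Omega> V2 1 D2 \<and>
     D0 ` C_inf \<Omega> V0 \<subseteq> C_inf \<Omega> V1 \<and> D1 ` C_inf \<Omega> V1 \<subseteq> C_inf \<Omega> V2 \<and> D2 ` C_inf \<Omega> V2 \<subseteq> C_inf \<Omega> V3 \<and>
     (\<forall>f\<in>C_inf \<Omega> V0. \<forall>x\<in>\<Omega>. D1 (D0 f) x = 0) \<and>
     (\<forall>g\<in>C_inf \<Omega> V1. \<forall>x\<in>\<Omega>. D2 (D1 g) x = 0) \<and>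
     (\<forall>x\<in>\<Omega>. \<forall>\<nu>. \<nu> \<noteq> 0 \<longrightarrow>
        inj_on (symbol \<Omega> V0 1 D0 x \<nu>) V0 \<and>
        symbol \<Omega> V0 1 D0 x \<nu> ` V0 = {u \<in> V1. symbol \<Omega> V1 2 D1 x \<nu> u = 0} \<and>
        symbol \<Omega> V1 2 D1 x \<nu> ` V1 = {u \<in> V2. symbol \<Omega> V2 1 D2 x \<nu> u = 0} \<and>
        symbol \<Omega> V2 1 D2 x \<nu> ` V2 = V3)"
proof -
  have "inj_on (symbol \<Omega> V0 1 D0 x \<nu>) V0 \<and>
        symbol \<Omega> V0 1 D0 x \<nu> ` V0 = {u \<in> V1. symbol \<Omega> V1 2 D1 x \<nu> u = 0} \<and>
        symbol \<Omega> V1 2 D1 x \<nu> ` V1 = {u \<in> V2. symbol \<Omega> V2 1 D2 x \<nu> u = 0} \<and>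
        symbol \<Omega> V2 1 D2 x \<nu> ` V2 = V3"
    if x: "x \<in> \<Omega>" and \<nu>: "\<nu> \<noteq> 0" for x and \<nu> :: "'n point"
  proof -
    note s0 = symbol_D0[OF x] and s1 = symbol_D1[OF assms(1) x] and s2 = symbol_D2[OF assms(1) x]
    have i0: "symbol \<Omega> V0 1 D0 x \<nu> ` V0 = symbol_0 \<nu> ` V0"
      by (rule image_cong[OF refl s0])
    have i1: "symbol \<Omega> V1 2 D1 x \<nu> ` V1 = symbol_1 \<nu> ` V1"
      by (rule image_cong[OF refl s1])
    have i2: "symbol \<Omega> V2 1 D2 x \<nu> ` V2 = symbol_2 \<nu> ` V2"
      by (rule image_cong[OF refl s2])
    have k1: "{u \<in> V1. symbol \<Omega> V1 2 D1 x \<nu> u = 0} = {u \<in> V1. symbol_1 \<nu> u = 0}"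
      by (rule Collect_cong, rule conj_cong[OF refl]) (simp only: s1)
    have k2: "{u \<in> V2. symbol \<Omega> V2 1 D2 x \<nu> u = 0} = {u \<in> V2. symbol_2 \<nu> u = 0}"
      by (rule Collect_cong, rule conj_cong[OF refl]) (simp only: s2)
    have "inj_on (symbol \<Omega> V0 1 D0 x \<nu>) V0"
      using inj_on_cong[of V0 "symbol \<Omega> V0 1 D0 x \<nu>" "symbol_0 \<nu>", OF s0]
        inj_on_subset[OF inj_symbol_0[OF \<nu>] subset_UNIV] by simp
    then show ?thesis
      unfolding i0 i1 i2 k1 k2 using symbol_sequence_exact[OF \<nu>] by (intro conjI)
  qed
  then have "\<forall>x\<in>\<Omega>. \<forall>\<nu>. \<nu> \<noteq> 0 \<longrightarrow>
        inj_on (symbol \<Omega> V0 1 D0 x \<nu>) V0 \<and>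
        symbol \<Omega> V0 1 D0 x \<nu> ` V0 = {u \<in> V1. symbol \<Omega> V1 2 D1 x \<nu> u = 0} \<and>
        symbol \<Omega> V1 2 D1 x \<nu> ` V1 = {u \<in> V2. symbol \<Omega> V2 1 D2 x \<nu> u = 0} \<and>
        symbol \<Omega> V2 1 D2 x \<nu> ` V2 = V3"
    by (intro ballI allI impI)
  moreover have "\<forall>f\<in>C_inf \<Omega> V0. \<forall>x\<in>\<Omega>. D1 (D0 f) x = 0"
    by (intro ballI) (rule D1_D0[OF assms(1) C_inf_smooth])
  moreover have "\<forall>g\<in>C_inf \<Omega> V1. \<forall>x\<in>\<Omega>. D2 (D1 g) x = 0"
    by (intro ballI) (rule D2_D1[OF assms(1) C_inf_smooth])
  ultimately show ?thesis
    using diff_ops[OF assms(1)] C_inf_maps[OF assms(1)] by (intro conjI)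
qed

end
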